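(* Fix any dimension $d\ge 2$. It is undecidable whether a given correlation-free cellular automaton (CFCA) $F$ of dimension $d$ is such that $F^2$ is a white noise cellular automaton (i.e. $\mathcal{S}_F^2(c)$ is the uniform measure for all configurations $c$). It is also undecidable, given a CFCA $F$ of dimension $d$, whether $F^2$ is noisy (i.e. every configuration can be reached from every configuration by $F^2$).
   Context: A stochastic cellular automaton of dimension $d$ is a tuple $\mathcal{A}=(Q,R,V,V',f)$ where $Q$ (states) and $R$ (random symbols) are finite sets, $V=\{v_1,\dots,v_\rho\}$ and $V'=\{v'_1,\dots,v'_{\rho'}\}$ are finite subsets of $\mathbb{Z}^d$, and $f:Q^\rho\times R^{\rho'}\to Q$ is the local function. It is a correlation-free CA (CFCA) if $V'=\{0\}$. It is identified with its explicit global function $F:Q^{\mathbb{Z}^d}\times R^{\mathbb{Z}^d}\to Q^{\mathbb{Z}^d}$, $F(c,s)_z=f\big((c_{z+v_j})_j,(s_{z+v'_j})_j\big)$. Iterates: $F^0(c)=c$ and $F^{t+1}(c,s^1,\dots,s^{t+1})=F(F^t(c,s^1,\dots,s^t),s^{t+1})$. $\mathcal{S}_F^t(c)$ is the law of $F^t(c,s^1,\dots,s^t)$ when $s^1,\dots,s^t$ are independent and each drawn from the uniform (i.i.d. uniform product) measure on $R^{\mathbb{Z}^d}$. $F^t$ is noisy if for every $c\in Q^{\mathbb{Z}^d}$, $\{F^t(c,s^1,\dots,s^t):s^1,\dots,s^t\in R^{\mathbb{Z}^d}\}=Q^{\mathbb{Z}^d}$. The uniform measure on $Q^{\mathbb{Z}^d}$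 is the i.i.d. uniform product measure. CA are given as inputs by their finite description $(Q,R,V,V',f)$. *)

theory Defs
  imports "HOL-Probability.Probability" "HOL-Library.Nat_Bijection"
begin

section \<open>Computability\<close>

text \<open>
  Kleene's partial recursive functions. Expressions carry no arity: a projection, the zero
  function and a minimisation apply to argument lists of any (sufficient) length, and an
  ill-formed application has no value. \<open>PrimRec\<close> recurses on the first argument,
  \<open>Mu\<close> searches for the first argument.
\<close>

datatype recf =
    Zero
  | Succ
  | Proj nat
  | Comp recf "recf list"
  | PrimRec recf recf
  | Mu recf

inductive recf_eval :: "recf \<Rightarrow> nat list \<Rightarrow> nat \<Rightarrow> bool" where
  eval_Zero: "recf_eval Zero xs 0"
| eval_Succ: "recf_eval Succ [x] (Suc x)"
| eval_Proj: "i < length xs \<Longrightarrow> recf_eval (Proj i) xs (xs ! i)"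
| eval_Comp: "list_all2 (\<lambda>g y. recf_eval g xs y) gs ys \<Longrightarrow> recf_eval f ys z
    \<Longrightarrow> recf_eval (Comp f gs) xs z"
| eval_PrimRec_0: "recf_eval f xs y \<Longrightarrow> recf_eval (PrimRec f g) (0 # xs) y"
| eval_PrimRec_Suc: "recf_eval (PrimRec f g) (n # xs) y \<Longrightarrow> recf_eval g (n # y # xs) z
    \<Longrightarrow> recf_eval (PrimRec f g) (Suc n # xs) z"
| eval_Mu: "recf_eval f (n # xs) 0 \<Longrightarrow> (\<forall>m<n. \<exists>y. recf_eval f (m # xs) (Suc y))
    \<Longrightarrow> recf_eval (Mu f) xs n"

text \<open>
  A decision problem consists of a set \<open>I\<close> of instances, presented through a numbering
  \<open>enc\<close>, and a property \<open>P\<close> of instances. The algorithm has to halt with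
  the right answer on every instance; nothing is required of it on numbers that do not encode
  an instance.
\<close>

definition decidable_problem :: "('a \<Rightarrow> nat) \<Rightarrow> 'a set \<Rightarrow> ('a \<Rightarrow> bool) \<Rightarrow> bool" where
  "decidable_problem enc I P \<longleftrightarrow>
     (\<exists>f. \<forall>x\<in>I. recf_eval f [enc x] (if P x then 1 else 0))"

section \<open>Stochastic cellular automata\<close>

text \<open>
  The finite description \<open>(Q, R, V, V', f)\<close>: \<open>Q = {..<states}\<close>,
  \<open>R = {..<symbols}\<close>, the neighbourhoods \<open>V\<close> and \<open>V'\<close> are
  enumerated by lists of integer vectors, and \<open>f\<close> is given by its table of values.
\<close>

record sca =
  states :: nat
  symbols :: nat
  nbhd :: "int list list"
  rnbhd :: "int list list"
  rule_table :: "nat list"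

definition cells :: "nat \<Rightarrow> int list set" where
  "cells d = {z. length z = d}"

definition is_sca :: "nat \<Rightarrow> sca \<Rightarrow> bool" where
  "is_sca d A \<longleftrightarrow>
     states A > 0 \<and> symbols A > 0 \<and>
     distinct (nbhd A) \<and> set (nbhd A) \<subseteq> cells d \<and>
     distinct (rnbhd A) \<and> set (rnbhd A) \<subseteq> cells d \<and>
     length (rule_table A) = states A ^ length (nbhd A) * symbols A ^ length (rnbhd A) \<and>
     set (rule_table A) \<subseteq> {..<states A}"

definition is_cfca :: "nat \<Rightarrow> sca \<Rightarrow> bool" where
  "is_cfca d A \<longleftrightarrow> is_sca d A \<and> set (rnbhd A) = {replicate d 0}"

definition encode_nbhd :: "int list list \<Rightarrow> nat" where
  "encode_nbhd vs = list_encode (map (\<lambda>v. list_encode (map int_encode v)) vs)"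

definition encode_sca :: "sca \<Rightarrow> nat" where
  "encode_sca A = list_encode
     [states A, symbols A, encode_nbhd (nbhd A), encode_nbhd (rnbhd A),
      list_encode (rule_table A)]"

text \<open>
  The value at \<open>(us, ws)\<close> is stored at the position whose mixed-radix expansion, least
  significant digit first, is \<open>us @ ws\<close>, the digits \<open>us\<close> being in base
  \<open>states A\<close> and the digits \<open>ws\<close> in base \<open>symbols A\<close>.
\<close>

definition local_fun :: "sca \<Rightarrow> nat list \<Rightarrow> nat list \<Rightarrow> nat" where
  "local_fun A us ws = rule_table A !
     (horner_sum id (states A) us + states A ^ length us * horner_sum id (symbols A) ws)"

text \<open>
  Configurations over \<open>{..<k}\<close> are extensional functions, that is, \<open>undefined\<close>
  outside \<open>cells d\<close>; this is the space of the product measure below.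
\<close>

definition configs :: "nat \<Rightarrow> nat \<Rightarrow> (int list \<Rightarrow> nat) set" where
  "configs d k = cells d \<rightarrow>\<^sub>E {..<k}"

definition global_fun ::
  "nat \<Rightarrow> sca \<Rightarrow> (int list \<Rightarrow> nat) \<Rightarrow> (int list \<Rightarrow> nat) \<Rightarrow> (int list \<Rightarrow> nat)" where
  "global_fun d A c s = (\<lambda>z\<in>cells d.
     local_fun A (map (\<lambda>v. c (map2 (+) z v)) (nbhd A))
                 (map (\<lambda>v. s (map2 (+) z v)) (rnbhd A)))"

text \<open>\<open>iterate d A t c s\<close> depends on \<open>s 1, \<dots>, s t\<close> only.\<close>

primrec iterate ::
  "nat \<Rightarrow> sca \<Rightarrow> nat \<Rightarrow> (int list \<Rightarrow> nat) \<Rightarrow> (nat \<Rightarrow> int list \<Rightarrow> nat) \<Rightarrow> (int list \<Rightarrow> nat)"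
where
  "iterate d A 0 c s = c"
| "iterate d A (Suc t) c s = global_fun d A (iterate d A t c s) (s (Suc t))"

definition uniform_config :: "nat \<Rightarrow> nat \<Rightarrow> (int list \<Rightarrow> nat) measure" where
  "uniform_config d k = (\<Pi>\<^sub>M z\<in>cells d. uniform_count_measure {..<k})"

definition law :: "nat \<Rightarrow> sca \<Rightarrow> nat \<Rightarrow> (int list \<Rightarrow> nat) \<Rightarrow> (int list \<Rightarrow> nat) measure" where
  "law d A t c = distr (\<Pi>\<^sub>M i\<in>{1..t}. uniform_config d (symbols A))
     (uniform_config d (states A)) (iterate d A t c)"

definition white_noise_iterate :: "nat \<Rightarrow> sca \<Rightarrow> nat \<Rightarrow> bool" where
  "white_noise_iterate d A t \<longleftrightarrow>
     (\<forall>c\<in>configs d (states A). law d A t c = uniform_config d (states A))"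

definition noisy_iterate :: "nat \<Rightarrow> sca \<Rightarrow> nat \<Rightarrow> bool" where
  "noisy_iterate d A t \<longleftrightarrow>
     (\<forall>c\<in>configs d (states A).
        {iterate d A t c s | s. \<forall>i\<in>{1..t}. s i \<in> configs d (symbols A)} = configs d (states A))"

end

theory Submission imports Defs begin

text \<open>
  A state of the automaton carries a tile that an adversary (the initial configuration) controls and
  random bits on the edges to neighbouring cells. A cell whose tile fits its surroundings outputs
  the sum modulo 2 of the bits on its incident edges, any other cell outputs a fresh random bit.
  The outputs of the second step are then independent and uniform, and every output
  is possible, unless some finite set of fitting cells has no edge leaving it: on such a
  closed set every edge bit is counted twice and the outputs add up to zero. The tiles
  are chosen so that a closed set is a space-time diagram of an accepting run of a
  register program, hence closed sets exist iff the program accepts. The input is the length of a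
  neighbourhood vector, which does not influence the table of the local function; so the program
  can be given the code of its own automaton, run a supposed decision algorithm on it, and accept
  iff the answer is "yes".
\<close>

section \<open>Recursive functions\<close>

text \<open>One step of a correlation-free automaton creates no correlations: given the
  configuration, different cells use independent random symbols. In the second step a bit drawn by
  one cell in the first is read by several cells, and a global obstruction becomes possible. Every
  edge bit occurs in at most two equations, as in the incidence matrix of a graph, so a finite
  nonempty set of equations sums to zero exactly if its cells form a closed set; this single
  obstruction governs both the law and reachability. A plain reduction from a halting problem would
  have to show that the table, indexed by all tuples of states, is computable from the program. Here
  the program is fixed and knows neither its table nor its number of states; a number that encodes
  both is its input, so that only the neighbourhoods and the outer list of \<open>encode_sca\<close>
  have to be computed. The register machine is nondeterministic because an adversary places the
  tiles: a guess followed by tests needs nothing but local checks.\<close>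

inductive_cases recf_evalE:
  "recf_eval Zero xs y" "recf_eval Succ xs y" "recf_eval (Proj i) xs y" "recf_eval (PrimRec f g) [] y"
  "recf_eval (PrimRec f g) (0 # xs) y"

inductive_cases recf_eval_PrimRec_SucE: "recf_eval (PrimRec f g) (Suc n # xs) y"

inductive_cases recf_eval_CompE: "recf_eval (Comp f gs) xs y"

inductive_cases recf_eval_MuE: "recf_eval (Mu f) xs y"

lemma recf_eval_det: "recf_eval f xs y \<Longrightarrow> recf_eval f xs z \<Longrightarrow> y = z"
proof (induction arbitrary: z rule: recf_eval.induct)
  case (eval_Comp xs gs ys f y)
  from eval_Comp.prems obtain zs where zs: "list_all2 (\<lambda>g y. recf_eval g xs y) gs zs"
    and z: "recf_eval f zs z"
    by (rule recf_eval_CompE)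
  have "ys = zs"
  proof (rule nth_equalityI)
    show "length ys = length zs" using eval_Comp.IH(1) zs by (simp add: list_all2_conv_all_nth)
    show "ys ! i = zs ! i" if "i < length ys" for i
      using eval_Comp.IH(1) zs that unfolding list_all2_conv_all_nth by metis
  qed
  with eval_Comp.IH(2) z show ?case by blast
next
  case (eval_PrimRec_Suc f g n xs y w)
  from eval_PrimRec_Suc.prems obtain y' where "recf_eval (PrimRec f g) (n # xs) y'"
    "recf_eval g (n # y' # xs) z"
    by (rule recf_eval_PrimRec_SucE)
  with eval_PrimRec_Suc.IH show ?case by metis
next
  case (eval_Mu f n xs)
  from eval_Mu.prems have z: "recf_eval f (z # xs) 0" "\<forall>m<z. \<exists>y. recf_eval f (m # xs) (Suc y)"
    by (auto elim: recf_eval_MuE)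
  have "\<not> z < n" using eval_Mu.IH(2) z(1) by blast
  moreover have "\<not> n < z" using eval_Mu.IH(1) z(2) by blast
  ultimately show ?case by simp
next
  case (eval_PrimRec_0 f xs y g)
  from eval_PrimRec_0.prems eval_PrimRec_0.IH show ?case by (blast elim: recf_evalE(5))
qed (blast elim: recf_evalE)+

text \<open>Expressions carry no arity, so the length of the argument list is fixed here; it makes
  the projections used below total.\<close>

definition rec_fun :: "nat \<Rightarrow> (nat list \<Rightarrow> nat) \<Rightarrow> bool" where
  "rec_fun n F \<longleftrightarrow> (\<exists>f. \<forall>xs. length xs = n \<longrightarrow> recf_eval f xs (F xs))"

lemma rec_fun_nth: "i < n \<Longrightarrow> rec_fun n (\<lambda>xs. xs ! i)"
  unfolding rec_fun_def by (intro exI[of _ "Proj i"]) (auto intro: eval_Proj)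

lemma rec_fun_Suc:
  assumes "rec_fun n F"
  shows "rec_fun n (\<lambda>xs. Suc (F xs))"
proof -
  obtain f where f: "\<forall>xs. length xs = n \<longrightarrow> recf_eval f xs (F xs)"
    using assms unfolding rec_fun_def by blast
  have "recf_eval (Comp Succ [f]) xs (Suc (F xs))" if "length xs = n" for xs
    using f that by (intro eval_Comp[where ys="[F xs]"]) (auto intro: eval_Succ)
  then show ?thesis unfolding rec_fun_def by blast
qed

lemma rec_fun_const: "rec_fun n (\<lambda>xs. c)"
proof (induction c)
  case 0
  show ?case unfolding rec_fun_def by (intro exI[of _ Zero]) (auto intro: eval_Zero)
qed (rule rec_fun_Suc)

lemma rec_fun_comp2:
  assumes "rec_fun 2 (\<lambda>xs. H (xs ! 0) (xs ! 1))" "rec_fun n F" "rec_fun n G"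
  shows "rec_fun n (\<lambda>xs. H (F xs) (G xs))"
proof -
  obtain h f g where "\<forall>xs. length xs = 2 \<longrightarrow> recf_eval h xs (H (xs ! 0) (xs ! 1))"
    "\<forall>xs. length xs = n \<longrightarrow> recf_eval f xs (F xs)" "\<forall>xs. length xs = n \<longrightarrow> recf_eval g xs (G xs)"
    using assms unfolding rec_fun_def by blast
  then have "recf_eval (Comp h [f, g]) xs (H (F xs) (G xs))" if "length xs = n" for xs
    using that by (intro eval_Comp[where ys="[F xs, G xs]"]) (auto dest!: spec[of _ "[F xs, G xs]"])
  then show ?thesis unfolding rec_fun_def by blast
qed

lemma rec_fun_PrimRec:
  assumes "rec_fun n F" "rec_fun (Suc (Suc n)) G"
    and "\<And>xs. H 0 xs = F xs" "\<And>k xs. H (Suc k) xs = G (k # H k xs # xs)"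
  shows "rec_fun (Suc n) (\<lambda>xs. H (hd xs) (tl xs))"
proof -
  obtain f g where f: "\<forall>xs. length xs = n \<longrightarrow> recf_eval f xs (F xs)"
    and g: "\<forall>xs. length xs = Suc (Suc n) \<longrightarrow> recf_eval g xs (G xs)"
    using assms unfolding rec_fun_def by blast
  have *: "recf_eval (PrimRec f g) (k # xs) (H k xs)" if "length xs = n" for k xs
  proof (induction k)
    case 0
    show ?case using f that by (auto intro: eval_PrimRec_0 simp: assms)
  next
    case (Suc k)
    then show ?case using g that by (auto intro!: eval_PrimRec_Suc simp: assms)
  qed
  show ?thesis unfolding rec_fun_def
    by (intro exI[of _ "PrimRec f g"]) (auto simp: length_Suc_conv *)
qed

lemma rec_fun_cong:
  assumes "rec_fun n F" "\<And>xs. length xs = n \<Longrightarrow> F xs = G xs"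
  shows "rec_fun n G"
  using assms unfolding rec_fun_def by metis

lemma rec_fun_add: "rec_fun 2 (\<lambda>xs. xs ! 0 + xs ! 1)"
proof -
  have "rec_fun (Suc 1) (\<lambda>xs. hd xs + (tl xs) ! 0)"
    by (rule rec_fun_PrimRec[where F="\<lambda>xs. xs ! 0" and G="\<lambda>xs. Suc (xs ! 1)"])
      (auto intro!: rec_fun_nth rec_fun_Suc)
  then have "rec_fun 2 (\<lambda>xs. hd xs + (tl xs) ! 0)" by (simp add: numeral_2_eq_2)
  then show ?thesis
    by (rule rec_fun_cong) (auto simp: numeral_2_eq_2 length_Suc_conv)
qed

text \<open>\<open>prod_encode (x, y)\<close> is \<open>triangle (x + y) + x\<close>, and the
  recursion \<open>triangle (Suc x) = triangle x + Suc x\<close> gets by without multiplication and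
  division.\<close>

lemma rec_fun_triangle: "rec_fun 1 (\<lambda>xs. triangle (xs ! 0))"
proof -
  have "rec_fun (Suc 0) (\<lambda>xs. triangle (hd xs))"
    by (rule rec_fun_PrimRec[where F="\<lambda>xs. 0" and G="\<lambda>xs. xs ! 1 + Suc (xs ! 0)"])
      (auto intro!: rec_fun_nth rec_fun_Suc rec_fun_const rec_fun_comp2[OF rec_fun_add, where n="Suc (Suc 0)"])
  then show ?thesis
    unfolding One_nat_def by (rule rec_fun_cong) (auto simp: length_Suc_conv)
qed

lemma rec_fun_comp1:
  assumes "rec_fun 1 (\<lambda>xs. H (xs ! 0))" "rec_fun n F"
  shows "rec_fun n (\<lambda>xs. H (F xs))"
proof -
  obtain h f where h: "\<forall>xs. length xs = 1 \<longrightarrow> recf_eval h xs (H (xs ! 0))"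
    and f: "\<forall>xs. length xs = n \<longrightarrow> recf_eval f xs (F xs)"
    using assms unfolding rec_fun_def by blast
  have "recf_eval (Comp h [f]) xs (H (F xs))" if "length xs = n" for xs
    using h[rule_format, of "[F xs]"] f that by (intro eval_Comp[where ys="[F xs]"]) auto
  then show ?thesis unfolding rec_fun_def by blast
qed

lemma rec_fun_prod_encode:
  assumes "rec_fun n F" "rec_fun n G"
  shows "rec_fun n (\<lambda>xs. prod_encode (F xs, G xs))"
  unfolding prod_encode_def prod.case
  by (intro rec_fun_comp2[OF rec_fun_add, where n=n] rec_fun_comp1[OF rec_fun_triangle] assms)

section \<open>Nondeterministic register programs\<close>

text \<open>There is no assignment. A guess relates two consecutive states register by register and
  a test looks at a single state, so both become conditions between adjacent tiles once states are
  written as rows.\<close>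

datatype instr = Havoc nat | TestEq nat nat | TestSuc nat nat | TestZero nat

datatype prog = Atom instr | Seq prog prog | Star prog

fun isem :: "instr \<Rightarrow> (nat \<Rightarrow> nat) \<Rightarrow> (nat \<Rightarrow> nat) \<Rightarrow> bool" where
  "isem (Havoc i) \<sigma> \<tau> \<longleftrightarrow> (\<exists>v. \<tau> = \<sigma>(i := v))"
| "isem (TestEq i j) \<sigma> \<tau> \<longleftrightarrow> \<tau> = \<sigma> \<and> \<sigma> i = \<sigma> j"
| "isem (TestSuc i j) \<sigma> \<tau> \<longleftrightarrow> \<tau> = \<sigma> \<and> \<sigma> i = Suc (\<sigma> j)"
| "isem (TestZero i) \<sigma> \<tau> \<longleftrightarrow> \<tau> = \<sigma> \<and> \<sigma> i = 0"

primrec psem :: "prog \<Rightarrow> (nat \<Rightarrow> nat) \<Rightarrow> (nat \<Rightarrow> nat) \<Rightarrow> bool" where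
  "psem (Atom a) = isem a"
| "psem (Seq P Q) = psem P OO psem Q"
| "psem (Star P) = (psem P)\<^sup>*\<^sup>*"

definition move :: "nat \<Rightarrow> nat \<Rightarrow> prog" where
  "move r s = Seq (Atom (Havoc r)) (Atom (TestEq r s))"

definition zero :: "nat \<Rightarrow> prog" where
  "zero r = Seq (Atom (Havoc r)) (Atom (TestZero r))"

text \<open>A test compares registers of one and the same state, and the old value of
  \<open>r\<close> is lost once \<open>r\<close> is guessed anew; hence the detour through the
  scratch register \<open>t\<close>.\<close>

definition incr :: "nat \<Rightarrow> nat \<Rightarrow> prog" where
  "incr r t = Seq (Atom (Havoc t)) (Seq (Atom (TestSuc t r)) (move r t))"

lemma psem_move: "r \<noteq> s \<Longrightarrow> psem (move r s) \<sigma> \<tau> \<longleftrightarrow> \<tau> = \<sigma>(r := \<sigma> s)"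
  by (auto simp: move_def OO_def)

lemma psem_zero: "psem (zero r) \<sigma> \<tau> \<longleftrightarrow> \<tau> = \<sigma>(r := 0)"
  by (auto simp: zero_def OO_def)

lemma psem_incr: "r \<noteq> t \<Longrightarrow> psem (incr r t) \<sigma> \<tau> \<longleftrightarrow> \<tau> = \<sigma>(t := Suc (\<sigma> r), r := Suc (\<sigma> r))"
  by (auto simp: incr_def OO_def psem_move)

section \<open>Compilation of recursive functions into register programs\<close>

definition agree :: "nat \<Rightarrow> (nat \<Rightarrow> nat) \<Rightarrow> (nat \<Rightarrow> nat) \<Rightarrow> bool" where
  "agree b \<sigma> \<tau> \<longleftrightarrow> (\<forall>r<b. \<sigma> r = \<tau> r)"

lemma agree_refl [simp]: "agree b \<sigma> \<sigma>"
  by (simp add: agree_def)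

lemma agree_map: "agree b \<sigma> \<tau> \<Longrightarrow> set rs \<subseteq> {..<b} \<Longrightarrow> map \<sigma> rs = map \<tau> rs"
  by (auto simp: agree_def)

text \<open>Registers from \<open>b\<close> on are free for intermediate results.\<close>

definition realizes :: "prog \<Rightarrow> nat \<Rightarrow> recf \<Rightarrow> nat list \<Rightarrow> nat \<Rightarrow> bool" where
  "realizes P b f rs r \<longleftrightarrow>
     (\<forall>\<sigma> \<tau>. psem P \<sigma> \<tau> \<longrightarrow> (\<exists>y. recf_eval f (map \<sigma> rs) y \<and> agree b \<tau> (\<sigma>(r := y)))) \<and>
     (\<forall>\<sigma> y. recf_eval f (map \<sigma> rs) y \<longrightarrow> (\<exists>\<tau>. psem P \<sigma> \<tau> \<and> agree b \<tau> (\<sigma>(r := y))))"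

text \<open>\<open>b\<close> varies so that a subprogram can be compiled with a larger bound and
  spare the registers of its context. The target may be overwritten before the arguments are read,
  so it must not be one of them.\<close>

definition compilable :: "recf \<Rightarrow> bool" where
  "compilable f \<longleftrightarrow> (\<forall>rs r b. set rs \<subseteq> {..<b} \<longrightarrow> r < b \<longrightarrow> r \<notin> set rs \<longrightarrow> (\<exists>P. realizes P b f rs r))"

lemma compilableI:
  assumes "\<And>rs r b. set rs \<subseteq> {..<b} \<Longrightarrow> r < b \<Longrightarrow> r \<notin> set rs \<Longrightarrow> \<exists>P. realizes P b f rs r"
  shows "compilable f"
  using assms unfolding compilable_def by blast

lemma compilableE:
  assumes "compilable f" "set rs \<subseteq> {..<b}" "r < b" "r \<notin> set rs"
  obtains P where
    "\<And>\<sigma> \<tau>. psem P \<sigma> \<tau> \<Longrightarrow> \<exists>y. recf_eval f (map \<sigma> rs) y \<and> agree b \<tau> (\<sigma>(r := y))"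
    "\<And>\<sigma> y. recf_eval f (map \<sigma> rs) y \<Longrightarrow> \<exists>\<tau>. psem P \<sigma> \<tau> \<and> agree b \<tau> (\<sigma>(r := y))"
  using assms unfolding compilable_def realizes_def by meson

lemma realizesI:
  assumes "\<And>\<sigma> \<tau>. psem P \<sigma> \<tau> \<Longrightarrow> \<exists>y. recf_eval f (map \<sigma> rs) y \<and> agree b \<tau> (\<sigma>(r := y))"
    "\<And>\<sigma> y. recf_eval f (map \<sigma> rs) y \<Longrightarrow> \<exists>\<tau>. psem P \<sigma> \<tau> \<and> agree b \<tau> (\<sigma>(r := y))"
  shows "\<exists>P. realizes P b f rs r"
  using assms unfolding realizes_def by blast

text \<open>A successor test of a register against itself never succeeds.\<close>

lemma realizes_empty: "(\<And>\<sigma> y. \<not> recf_eval f (map \<sigma> rs) y) \<Longrightarrow> \<exists>P. realizes P b f rs r"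
  by (rule realizesI[where P="Atom (TestSuc r r)"]) auto

lemma compilable_Zero: "compilable Zero"
proof (rule compilableI)
  fix rs :: "nat list" and r b :: nat
  show "\<exists>P. realizes P b Zero rs r"
    by (rule realizesI[where P="zero r"])
      (auto simp: psem_zero intro: eval_Zero elim!: recf_evalE)
qed

text \<open>Applied to a list of length other than one, \<open>Succ\<close> has no value.
  Realization also covers undefinedness, so in that case the program must have no run at
  all.\<close>

lemma compilable_Succ: "compilable Succ"
proof (rule compilableI)
  fix rs :: "nat list" and r b :: nat assume *: "set rs \<subseteq> {..<b}" "r < b" "r \<notin> set rs"
  show "\<exists>P. realizes P b Succ rs r"
  proof (cases "\<exists>x. rs = [x]")
    case True
    then obtain x where x: "rs = [x]" by blast
    with * have "x \<noteq> r" by auto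
    then have P: "psem (Seq (Atom (Havoc r)) (Atom (TestSuc r x))) \<sigma> \<tau> \<longleftrightarrow> \<tau> = \<sigma>(r := Suc (\<sigma> x))" for \<sigma> \<tau>
      by (auto simp: OO_def)
    have ev: "recf_eval Succ (map \<sigma> rs) y \<longleftrightarrow> y = Suc (\<sigma> x)" for \<sigma> y
      by (auto simp: x intro: eval_Succ elim!: recf_evalE)
    show ?thesis
      by (rule realizesI[where P="Seq (Atom (Havoc r)) (Atom (TestSuc r x))"], unfold P ev) auto
  next
    case False
    show ?thesis
      by (rule realizes_empty) (use False in \<open>auto elim!: recf_evalE\<close>)
  qed
qed

lemma compilable_Proj: "compilable (Proj i)"
proof (rule compilableI)
  fix rs :: "nat list" and r b :: nat assume *: "set rs \<subseteq> {..<b}" "r < b" "r \<notin> set rs"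
  show "\<exists>P. realizes P b (Proj i) rs r"
  proof (cases "i < length rs")
    case True
    with * have "rs ! i \<noteq> r" by (metis nth_mem)
    then have P: "psem (move r (rs ! i)) \<sigma> \<tau> \<longleftrightarrow> \<tau> = \<sigma>(r := \<sigma> (rs ! i))" for \<sigma> \<tau>
      by (simp add: psem_move)
    have ev: "recf_eval (Proj i) (map \<sigma> rs) y \<longleftrightarrow> y = \<sigma> (rs ! i)" for \<sigma> y
    proof
      show "y = \<sigma> (rs ! i) \<Longrightarrow> recf_eval (Proj i) (map \<sigma> rs) y"
        using eval_Proj[of i "map \<sigma> rs"] True by simp
    qed (auto elim!: recf_evalE)
    show ?thesis
      by (rule realizesI[where P="move r (rs ! i)"], unfold P ev) auto
  next
    case False
    show ?thesis
      by (rule realizes_empty) (use False in \<open>auto elim!: recf_evalE\<close>)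
  qed
qed

text \<open>The results go to consecutive registers from \<open>b\<close> on. Compiling the tail
  with the bound \<open>Suc b\<close> protects the result just computed, and the arguments lie below
  \<open>b\<close>, so that every \<open>g\<close> still reads them unchanged.\<close>

lemma compile_list:
  assumes "\<forall>g\<in>set gs. compilable g" "set rs \<subseteq> {..<b}"
  shows "\<exists>P. (\<forall>\<sigma> \<tau>. psem P \<sigma> \<tau> \<longrightarrow>
                list_all2 (\<lambda>g y. recf_eval g (map \<sigma> rs) y) gs (map \<tau> [b..<b + length gs]) \<and> agree b \<tau> \<sigma>) \<and>
             (\<forall>\<sigma> ys. list_all2 (\<lambda>g y. recf_eval g (map \<sigma> rs) y) gs ys \<longrightarrow>
                (\<exists>\<tau>. psem P \<sigma> \<tau> \<and> map \<tau> [b..<b + length gs] = ys \<and> agree b \<tau> \<sigma>))"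
  using assms
proof (induction gs arbitrary: b)
  case Nil
  \<comment> \<open>\<open>TestEq 0 0\<close> always succeeds and changes nothing, so it serves as
    the empty program.\<close>
  show ?case by (rule exI[of _ "Atom (TestEq 0 0)"]) simp
next
  case (Cons g gs)
  obtain P where
    P1: "\<And>\<sigma> \<tau>. psem P \<sigma> \<tau> \<Longrightarrow> \<exists>y. recf_eval g (map \<sigma> rs) y \<and> agree (Suc b) \<tau> (\<sigma>(b := y))" and
    P2: "\<And>\<sigma> y. recf_eval g (map \<sigma> rs) y \<Longrightarrow> \<exists>\<tau>. psem P \<sigma> \<tau> \<and> agree (Suc b) \<tau> (\<sigma>(b := y))"
    by (rule compilableE[of g rs "Suc b" b]) (use Cons.prems in auto)
  obtain Q where
    Q1: "\<And>\<sigma> \<tau>. psem Q \<sigma> \<tau> \<Longrightarrow>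
      list_all2 (\<lambda>g y. recf_eval g (map \<sigma> rs) y) gs (map \<tau> [Suc b..<Suc b + length gs]) \<and> agree (Suc b) \<tau> \<sigma>" and
    Q2: "\<And>\<sigma> ys. list_all2 (\<lambda>g y. recf_eval g (map \<sigma> rs) y) gs ys \<Longrightarrow>
       \<exists>\<tau>. psem Q \<sigma> \<tau> \<and> map \<tau> [Suc b..<Suc b + length gs] = ys \<and> agree (Suc b) \<tau> \<sigma>"
  proof -
    have "\<forall>g\<in>set gs. compilable g" "set rs \<subseteq> {..<Suc b}" using Cons.prems by auto
    from Cons.IH[OF this] show ?thesis using that by blast
  qed
  have upt: "[b..<b + length (g # gs)] = b # [Suc b..<Suc b + length gs]"
    using upt_conv_Cons[of b "b + length (g # gs)"] by (simp del: upt_Suc)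
  have ag: "agree b \<tau> \<sigma> \<and> map \<tau> rs = map \<sigma> rs \<and> \<tau> b = y" if "agree (Suc b) \<tau> (\<sigma>(b := y))" for \<sigma> \<tau> y
    using that Cons.prems(2) unfolding agree_def by auto
  show ?case unfolding upt
  proof (intro exI[of _ "Seq P Q"] conjI allI impI)
    fix \<sigma> \<tau> assume "psem (Seq P Q) \<sigma> \<tau>"
    then obtain \<rho> where "psem P \<sigma> \<rho>" "psem Q \<rho> \<tau>" by auto
    from P1[OF this(1)] Q1[OF this(2)] obtain y where y: "recf_eval g (map \<sigma> rs) y"
      "agree (Suc b) \<rho> (\<sigma>(b := y))"
      "list_all2 (\<lambda>g y. recf_eval g (map \<rho> rs) y) gs (map \<tau> [Suc b..<Suc b + length gs])"
      "agree (Suc b) \<tau> \<rho>" by blast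
    have "\<tau> b = y" "agree b \<tau> \<sigma>" using ag[OF y(2)] y(4) by (auto simp: agree_def)
    moreover have "map \<rho> rs = map \<sigma> rs" using ag[OF y(2)] by blast
    ultimately show "list_all2 (\<lambda>g y. recf_eval g (map \<sigma> rs) y) (g # gs) (map \<tau> (b # [Suc b..<Suc b + length gs]))"
       "agree b \<tau> \<sigma>" using y by (simp_all del: upt_Suc map_eq_conv)
  next
    fix \<sigma> ys assume "list_all2 (\<lambda>g y. recf_eval g (map \<sigma> rs) y) (g # gs) ys"
    then obtain z zs where ys: "ys = z # zs" and z: "recf_eval g (map \<sigma> rs) z"
      and zs: "list_all2 (\<lambda>g y. recf_eval g (map \<sigma> rs) y) gs zs"
      by (auto simp: list_all2_Cons1)
    from P2[OF z] obtain \<rho> where \<rho>: "psem P \<sigma> \<rho>" "agree (Suc b) \<rho> (\<sigma>(b := z))" by blast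
    from Q2[of \<rho> zs] zs ag[OF \<rho>(2)] obtain \<tau> where \<tau>: "psem Q \<rho> \<tau>"
      "map \<tau> [Suc b..<Suc b + length gs] = zs" "agree (Suc b) \<tau> \<rho>" by auto
    have "\<tau> b = z" "agree b \<tau> \<sigma>" using ag[OF \<rho>(2)] \<tau>(3) by (auto simp: agree_def)
    with \<rho> \<tau> ys show "\<exists>\<tau>. psem (Seq P Q) \<sigma> \<tau> \<and> map \<tau> (b # [Suc b..<Suc b + length gs]) = ys \<and> agree b \<tau> \<sigma>"
      by (intro exI[of _ \<tau>]) auto
  qed
qed

lemma compilable_Comp:
  assumes "compilable f" "\<forall>g\<in>set gs. compilable g"
  shows "compilable (Comp f gs)"
proof (rule compilableI)
  fix rs :: "nat list" and r b :: nat assume *: "set rs \<subseteq> {..<b}" "r < b" "r \<notin> set rs"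
  define b' where "b' = b + length gs"
  obtain Q where
    Q1: "\<And>\<sigma> \<tau>. psem Q \<sigma> \<tau> \<Longrightarrow>
      list_all2 (\<lambda>g y. recf_eval g (map \<sigma> rs) y) gs (map \<tau> [b..<b']) \<and> agree b \<tau> \<sigma>" and
    Q2: "\<And>\<sigma> ys. list_all2 (\<lambda>g y. recf_eval g (map \<sigma> rs) y) gs ys \<Longrightarrow>
       \<exists>\<tau>. psem Q \<sigma> \<tau> \<and> map \<tau> [b..<b'] = ys \<and> agree b \<tau> \<sigma>"
    using compile_list[OF assms(2) *(1)] unfolding b'_def by blast
  obtain P where
    P1: "\<And>\<sigma> \<tau>. psem P \<sigma> \<tau> \<Longrightarrow> \<exists>y. recf_eval f (map \<sigma> [b..<b']) y \<and> agree b' \<tau> (\<sigma>(r := y))" and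
    P2: "\<And>\<sigma> y. recf_eval f (map \<sigma> [b..<b']) y \<Longrightarrow> \<exists>\<tau>. psem P \<sigma> \<tau> \<and> agree b' \<tau> (\<sigma>(r := y))"
    by (rule compilableE[OF assms(1), of "[b..<b']" b' r]) (use * in \<open>auto simp: b'_def\<close>)
  have ag: "agree b \<tau> (\<sigma>(r := y))" if "agree b' \<tau> (\<rho>(r := y))" "agree b \<rho> \<sigma>" for \<tau> \<rho> \<sigma> y
    using that by (auto simp: agree_def b'_def)
  show "\<exists>P. realizes P b (Comp f gs) rs r"
  proof (rule realizesI[where P="Seq Q P"])
    fix \<sigma> \<tau> assume "psem (Seq Q P) \<sigma> \<tau>"
    then obtain \<rho> where "psem Q \<sigma> \<rho>" "psem P \<rho> \<tau>" by auto
    with Q1 P1 obtain y where "list_all2 (\<lambda>g y. recf_eval g (map \<sigma> rs) y) gs (map \<rho> [b..<b'])" "agree b \<rho> \<sigma>"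
       "recf_eval f (map \<rho> [b..<b']) y" "agree b' \<tau> (\<rho>(r := y))" by blast
    then show "\<exists>y. recf_eval (Comp f gs) (map \<sigma> rs) y \<and> agree b \<tau> (\<sigma>(r := y))"
      using ag by (intro exI[of _ y]) (auto intro: eval_Comp)
  next
    fix \<sigma> y assume "recf_eval (Comp f gs) (map \<sigma> rs) y"
    then obtain ys where ys: "list_all2 (\<lambda>g y. recf_eval g (map \<sigma> rs) y) gs ys" "recf_eval f ys y"
      by cases
    from Q2[OF ys(1)] obtain \<rho> where \<rho>: "psem Q \<sigma> \<rho>" "map \<rho> [b..<b'] = ys" "agree b \<rho> \<sigma>" by blast
    with P2[of \<rho> y] ys(2) obtain \<tau> where "psem P \<rho> \<tau>" "agree b' \<tau> (\<rho>(r := y))" by auto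
    with \<rho> ag show "\<exists>\<tau>. psem (Seq Q P) \<sigma> \<tau> \<and> agree b \<tau> (\<sigma>(r := y))" by auto
  qed
qed

text \<open>The loop keeps the value of the recursion at \<open>i\<close> in \<open>acc\<close>
  while \<open>i\<close> counts up. \<open>Star\<close> may stop at any moment; the test against
  \<open>n\<close> discards the runs that stopped elsewhere. The result of \<open>g\<close> goes to
  \<open>new\<close> because \<open>acc\<close> is among the arguments of \<open>g\<close>.\<close>

lemma compilable_PrimRec:
  assumes "compilable f" "compilable g"
  shows "compilable (PrimRec f g)"
proof (rule compilableI)
  fix rs :: "nat list" and r b :: nat assume *: "set rs \<subseteq> {..<b}" "r < b" "r \<notin> set rs"
  show "\<exists>P. realizes P b (PrimRec f g) rs r"
  proof (cases rs)
    case Nil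
    show ?thesis
      by (rule realizes_empty) (use Nil in \<open>auto elim!: recf_evalE\<close>)
  next
    case (Cons n xs)
    have xs: "set xs \<subseteq> {..<b}" and n: "n < b" using * Cons by auto
    define i where "i = b"
    define acc where "acc = Suc b"
    define new where "new = Suc (Suc b)"
    define tmp where "tmp = Suc (Suc (Suc b))"
    define b' where "b' = Suc (Suc (Suc (Suc b)))"
    note defs = i_def acc_def new_def tmp_def b'_def
    obtain Pf where
      F1: "\<And>\<sigma> \<tau>. psem Pf \<sigma> \<tau> \<Longrightarrow> \<exists>y. recf_eval f (map \<sigma> xs) y \<and> agree b' \<tau> (\<sigma>(acc := y))" and
      F2: "\<And>\<sigma> y. recf_eval f (map \<sigma> xs) y \<Longrightarrow> \<exists>\<tau>. psem Pf \<sigma> \<tau> \<and> agree b' \<tau> (\<sigma>(acc := y))"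
      by (rule compilableE[OF assms(1), of xs b' acc]) (use xs in \<open>auto simp: defs\<close>)
    obtain Pg where
      G1: "\<And>\<sigma> \<tau>. psem Pg \<sigma> \<tau> \<Longrightarrow> \<exists>y. recf_eval g (map \<sigma> (i # acc # xs)) y \<and> agree b' \<tau> (\<sigma>(new := y))" and
      G2: "\<And>\<sigma> y. recf_eval g (map \<sigma> (i # acc # xs)) y \<Longrightarrow> \<exists>\<tau>. psem Pg \<sigma> \<tau> \<and> agree b' \<tau> (\<sigma>(new := y))"
      by (rule compilableE[OF assms(2), of "i # acc # xs" b' new]) (use xs in \<open>auto simp: defs\<close>)
    define B where "B = Seq Pg (Seq (move acc new) (incr i tmp))"
    define P where "P = Seq (zero i) (Seq Pf (Seq (Star B) (Seq (Atom (TestEq i n)) (move r acc))))"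
    have mv: "psem (move acc new) \<sigma> \<tau> \<longleftrightarrow> \<tau> = \<sigma>(acc := \<sigma> new)"
         "psem (move r acc) \<sigma> \<tau> \<longleftrightarrow> \<tau> = \<sigma>(r := \<sigma> acc)"
         "psem (incr i tmp) \<sigma> \<tau> \<longleftrightarrow> \<tau> = \<sigma>(tmp := Suc (\<sigma> i), i := Suc (\<sigma> i))" for \<sigma> \<tau>
      using *(2) by (auto simp: psem_move psem_incr defs)
    have B1: "\<exists>y. recf_eval g (\<sigma> i # \<sigma> acc # map \<sigma> xs) y \<and> \<tau> i = Suc (\<sigma> i) \<and> \<tau> acc = y \<and> agree b \<tau> \<sigma>"
      if "psem B \<sigma> \<tau>" for \<sigma> \<tau>
    proof -
      have "i \<noteq> acc" by (simp add: defs)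
      with that obtain \<rho> where \<rho>: "psem Pg \<sigma> \<rho>"
        "\<tau> = (\<rho>(acc := \<rho> new))(tmp := Suc (\<rho> i), i := Suc (\<rho> i))"
        by (auto simp: B_def OO_def mv)
      from G1[OF \<rho>(1)] show ?thesis
        using \<rho>(2) by (auto simp: agree_def defs)
    qed
    have B2: "\<exists>\<tau>. psem B \<sigma> \<tau> \<and> \<tau> i = Suc (\<sigma> i) \<and> \<tau> acc = y \<and> agree b \<tau> \<sigma>"
      if "recf_eval g (\<sigma> i # \<sigma> acc # map \<sigma> xs) y" for \<sigma> y
    proof -
      from G2[of \<sigma> y] that obtain \<rho> where \<rho>: "psem Pg \<sigma> \<rho>" "agree b' \<rho> (\<sigma>(new := y))" by auto
      show ?thesis
      proof (intro exI[of _ "(\<rho>(acc := \<rho> new))(tmp := Suc (\<rho> i), i := Suc (\<rho> i))"] conjI)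
        have "i \<noteq> acc" by (simp add: defs)
        then show "psem B \<sigma> ((\<rho>(acc := \<rho> new))(tmp := Suc (\<rho> i), i := Suc (\<rho> i)))"
          using \<rho>(1) by (auto simp: B_def OO_def mv)
      qed (use \<rho> in \<open>auto simp: agree_def defs\<close>)
    qed
    show ?thesis
    proof (rule realizesI[where P=P])
      fix \<sigma> \<tau> assume "psem P \<sigma> \<tau>"
      then obtain \<sigma>1 \<sigma>2 where s: "psem Pf (\<sigma>(i := 0)) \<sigma>1" "(psem B)\<^sup>*\<^sup>* \<sigma>1 \<sigma>2"
        "\<sigma>2 i = \<sigma>2 n" "\<tau> = \<sigma>2(r := \<sigma>2 acc)"
        by (auto simp: P_def OO_def mv psem_zero)
      have xs0: "map (\<sigma>(i := 0)) xs = map \<sigma> xs" using xs by (auto simp: defs)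
      have "agree b \<sigma>2 \<sigma> \<and> recf_eval (PrimRec f g) (\<sigma>2 i # map \<sigma> xs) (\<sigma>2 acc)"
        using s(2)
      proof (induction rule: rtranclp_induct)
        case base
        from F1[OF s(1)] obtain y where y: "recf_eval f (map \<sigma> xs) y" "agree b' \<sigma>1 (\<sigma>(i := 0, acc := y))"
          unfolding xs0 by auto
        then have "\<sigma>1 i = 0" "\<sigma>1 acc = y" "agree b \<sigma>1 \<sigma>" by (auto simp: agree_def defs)
        with y(1) show ?case by (auto intro: eval_PrimRec_0)
      next
        case (step \<rho> \<rho>')
        from B1[OF step(2)] step(3) agree_map[OF _ xs, of \<rho> \<sigma>]
        obtain y where "recf_eval g (\<rho> i # \<rho> acc # map \<sigma> xs) y" "\<rho>' i = Suc (\<rho> i)" "\<rho>' acc = y"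
          "agree b \<rho>' \<rho>" by auto
        with step(3) show ?case by (auto simp: agree_def intro: eval_PrimRec_Suc)
      qed
      then show "\<exists>y. recf_eval (PrimRec f g) (map \<sigma> rs) y \<and> agree b \<tau> (\<sigma>(r := y))"
        using s(3,4) n by (intro exI[of _ "\<sigma>2 acc"]) (auto simp: Cons agree_def)
    next
      fix \<sigma> y assume y: "recf_eval (PrimRec f g) (map \<sigma> rs) y"
      have "\<exists>\<sigma>1 \<tau>. psem Pf (\<sigma>(i := 0)) \<sigma>1 \<and> (psem B)\<^sup>*\<^sup>* \<sigma>1 \<tau> \<and> \<tau> i = k \<and> \<tau> acc = y \<and> agree b \<tau> \<sigma>"
        if "recf_eval (PrimRec f g) (k # map \<sigma> xs) y" for k y
        using that
      proof (induction k arbitrary: y)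
        case 0
        from 0 have "recf_eval f (map \<sigma> xs) y" by cases
        moreover have xs0: "map (\<sigma>(i := 0)) xs = map \<sigma> xs" using xs by (auto simp: defs)
        ultimately obtain \<tau> where "psem Pf (\<sigma>(i := 0)) \<tau>" "agree b' \<tau> (\<sigma>(i := 0, acc := y))"
          using F2[of "\<sigma>(i := 0)" y] unfolding xs0 by blast
        moreover from this have "\<tau> i = 0" "\<tau> acc = y" "agree b \<tau> \<sigma>" by (auto simp: agree_def defs)
        ultimately show ?case by blast
      next
        case (Suc k)
        from Suc.prems obtain z where z: "recf_eval (PrimRec f g) (k # map \<sigma> xs) z"
          "recf_eval g (k # z # map \<sigma> xs) y"
          by cases
        from Suc.IH[OF z(1)] obtain \<sigma>1 \<tau> where \<tau>: "psem Pf (\<sigma>(i := 0)) \<sigma>1" "(psem B)\<^sup>*\<^sup>* \<sigma>1 \<tau>"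
          "\<tau> i = k" "\<tau> acc = z" "agree b \<tau> \<sigma>" by blast
        from z(2) \<tau>(3,4) agree_map[OF \<tau>(5) xs] have "recf_eval g (\<tau> i # \<tau> acc # map \<tau> xs) y"
          by (simp del: map_eq_conv)
        from B2[OF this] \<tau>(3) obtain \<tau>' where "psem B \<tau> \<tau>'" "\<tau>' i = Suc k" "\<tau>' acc = y"
          "agree b \<tau>' \<tau>" by auto
        moreover from this \<tau>(2) have "(psem B)\<^sup>*\<^sup>* \<sigma>1 \<tau>'" by (meson rtranclp.rtrancl_into_rtrancl)
        moreover from calculation \<tau>(5) have "agree b \<tau>' \<sigma>" by (simp add: agree_def)
        ultimately show ?case using \<tau>(1) by blast
      qed
      from this[of "\<sigma> n" y] y Cons obtain \<sigma>1 \<tau> where \<tau>: "psem Pf (\<sigma>(i := 0)) \<sigma>1" "(psem B)\<^sup>*\<^sup>* \<sigma>1 \<tau>"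
        "\<tau> i = \<sigma> n" "\<tau> acc = y" "agree b \<tau> \<sigma>" by auto
      then have "\<tau> i = \<tau> n" using n by (simp add: agree_def)
      with \<tau>(1,2) have "psem P \<sigma> (\<tau>(r := \<tau> acc))"
        unfolding P_def psem.simps OO_def mv psem_zero isem.simps by blast
      with \<tau>(4,5) show "\<exists>\<tau>. psem P \<sigma> \<tau> \<and> agree b \<tau> (\<sigma>(r := y))"
        by (intro exI[of _ "\<tau>(r := \<tau> acc)"]) (auto simp: agree_def)
    qed
  qed
qed

text \<open>Each round of the loop certifies a positive value of \<open>f\<close> at the current
  counter, the guessed predecessor \<open>prd\<close> of \<open>out\<close> being the certificate.
  After the loop \<open>f\<close> is evaluated once more and must give zero, so a run exists exactly
  if the search has a value, even where \<open>f\<close> is partial.\<close>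

lemma compilable_Mu:
  assumes "compilable f"
  shows "compilable (Mu f)"
proof (rule compilableI)
  fix xs :: "nat list" and r b :: nat assume *: "set xs \<subseteq> {..<b}" "r < b" "r \<notin> set xs"
  define i where "i = b"
  define out where "out = Suc b"
  define prd where "prd = Suc (Suc b)"
  define tmp where "tmp = Suc (Suc (Suc b))"
  define b' where "b' = Suc (Suc (Suc (Suc b)))"
  note defs = i_def out_def prd_def tmp_def b'_def
  obtain Pf where
    F1: "\<And>\<sigma> \<tau>. psem Pf \<sigma> \<tau> \<Longrightarrow> \<exists>y. recf_eval f (map \<sigma> (i # xs)) y \<and> agree b' \<tau> (\<sigma>(out := y))" and
    F2: "\<And>\<sigma> y. recf_eval f (map \<sigma> (i # xs)) y \<Longrightarrow> \<exists>\<tau>. psem Pf \<sigma> \<tau> \<and> agree b' \<tau> (\<sigma>(out := y))"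
    by (rule compilableE[OF assms(1), of "i # xs" b' out]) (use * in \<open>auto simp: defs\<close>)
  define B where "B = Seq Pf (Seq (Atom (Havoc prd)) (Seq (Atom (TestSuc out prd)) (incr i tmp)))"
  define P where "P = Seq (zero i) (Seq (Star B) (Seq Pf (Seq (Atom (TestZero out)) (move r i))))"
  have mv: "psem (move r i) \<sigma> \<tau> \<longleftrightarrow> \<tau> = \<sigma>(r := \<sigma> i)"
       "psem (incr i tmp) \<sigma> \<tau> \<longleftrightarrow> \<tau> = \<sigma>(tmp := Suc (\<sigma> i), i := Suc (\<sigma> i))" for \<sigma> \<tau>
    using *(2) by (auto simp: psem_move psem_incr defs)
  have B1: "\<exists>y. recf_eval f (\<sigma> i # map \<sigma> xs) (Suc y) \<and> \<tau> i = Suc (\<sigma> i) \<and> agree b \<tau> \<sigma>"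
    if "psem B \<sigma> \<tau>" for \<sigma> \<tau>
  proof -
    have "out \<noteq> prd" "i \<noteq> prd" by (simp_all add: defs)
    with that obtain \<rho> v where \<rho>: "psem Pf \<sigma> \<rho>" "\<rho> out = Suc v"
      "\<tau> = \<rho>(prd := v, tmp := Suc (\<rho> i), i := Suc (\<rho> i))"
      by (auto simp: B_def OO_def mv)
    from F1[OF \<rho>(1)] show ?thesis
      using \<rho>(2,3) by (intro exI[of _ v]) (auto simp: agree_def defs)
  qed
  have B2: "\<exists>\<tau>. psem B \<sigma> \<tau> \<and> \<tau> i = Suc (\<sigma> i) \<and> agree b \<tau> \<sigma>"
    if "recf_eval f (\<sigma> i # map \<sigma> xs) (Suc y)" for \<sigma> y
  proof -
    from F2[of \<sigma> "Suc y"] that obtain \<rho> where \<rho>: "psem Pf \<sigma> \<rho>" "agree b' \<rho> (\<sigma>(out := Suc y))" by auto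
    show ?thesis
    proof (intro exI[of _ "\<rho>(prd := y, tmp := Suc (\<rho> i), i := Suc (\<rho> i))"] conjI)
      have "i \<noteq> prd" "out \<noteq> prd" "\<rho> out = Suc y" using \<rho>(2) by (auto simp: agree_def defs)
      then have "psem (Seq (Atom (Havoc prd)) (Seq (Atom (TestSuc out prd)) (incr i tmp))) \<rho>
        (\<rho>(prd := y, tmp := Suc (\<rho> i), i := Suc (\<rho> i)))"
        by (auto simp: OO_def mv intro!: exI[of _ "\<rho>(prd := y)"])
      then show "psem B \<sigma> (\<rho>(prd := y, tmp := Suc (\<rho> i), i := Suc (\<rho> i)))"
        using \<rho>(1) unfolding B_def by auto
    qed (use \<rho> in \<open>auto simp: agree_def defs\<close>)
  qed
  show "\<exists>P. realizes P b (Mu f) xs r"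
  proof (rule realizesI[where P=P])
    fix \<sigma> \<tau> assume "psem P \<sigma> \<tau>"
    then obtain \<sigma>1 \<sigma>2 where s: "(psem B)\<^sup>*\<^sup>* (\<sigma>(i := 0)) \<sigma>1" "psem Pf \<sigma>1 \<sigma>2"
      "\<sigma>2 out = 0" "\<tau> = \<sigma>2(r := \<sigma>2 i)"
      by (auto simp: P_def OO_def mv psem_zero)
    have 1: "agree b \<sigma>1 \<sigma> \<and> (\<forall>m<\<sigma>1 i. \<exists>y. recf_eval f (m # map \<sigma> xs) (Suc y))"
      using s(1)
    proof (induction rule: rtranclp_induct)
      case base
      show ?case by (auto simp: agree_def defs)
    next
      case (step \<rho> \<rho>')
      from B1[OF step(2)] step(3) agree_map[OF _ *(1), of \<rho> \<sigma>]
      obtain y where "recf_eval f (\<rho> i # map \<sigma> xs) (Suc y)" "\<rho>' i = Suc (\<rho> i)"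
        "agree b \<rho>' \<rho>" by auto
      with step(3) show ?case by (auto simp: agree_def less_Suc_eq)
    qed
    from F1[OF s(2)] obtain y where y: "recf_eval f (map \<sigma>1 (i # xs)) y" "agree b' \<sigma>2 (\<sigma>1(out := y))" by blast
    have "y = 0" using y(2) s(3) by (auto simp: agree_def defs)
    with y 1 agree_map[OF _ *(1), of \<sigma>1 \<sigma>] have "recf_eval f (\<sigma>1 i # map \<sigma> xs) 0" by auto
    with 1 have "recf_eval (Mu f) (map \<sigma> xs) (\<sigma>1 i)" by (auto intro: eval_Mu)
    moreover have "\<sigma>2 i = \<sigma>1 i" "agree b \<sigma>2 \<sigma>1" using y(2) by (auto simp: agree_def defs)
    ultimately show "\<exists>y. recf_eval (Mu f) (map \<sigma> xs) y \<and> agree b \<tau> (\<sigma>(r := y))"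
      using s(4) 1 by (intro exI[of _ "\<sigma>1 i"]) (auto simp: agree_def)
  next
    fix \<sigma> n assume "recf_eval (Mu f) (map \<sigma> xs) n"
    then have n: "recf_eval f (n # map \<sigma> xs) 0" "\<forall>m<n. \<exists>y. recf_eval f (m # map \<sigma> xs) (Suc y)"
      by (cases; blast)+
    have "\<exists>\<tau>. (psem B)\<^sup>*\<^sup>* (\<sigma>(i := 0)) \<tau> \<and> \<tau> i = k \<and> agree b \<tau> \<sigma>" if "k \<le> n" for k
      using that
    proof (induction k)
      case 0
      show ?case by (intro exI[of _ "\<sigma>(i := 0)"]) (auto simp: agree_def defs)
    next
      case (Suc k)
      then obtain \<tau> where \<tau>: "(psem B)\<^sup>*\<^sup>* (\<sigma>(i := 0)) \<tau>" "\<tau> i = k" "agree b \<tau> \<sigma>"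
        using Suc_leD by blast
      from Suc.prems n(2) obtain y where "recf_eval f (k # map \<sigma> xs) (Suc y)"
        using Suc_le_lessD by blast
      with \<tau>(2) agree_map[OF \<tau>(3) *(1)] have "recf_eval f (\<tau> i # map \<tau> xs) (Suc y)"
        by (simp del: map_eq_conv)
      from B2[OF this] \<tau>(2) obtain \<tau>' where "psem B \<tau> \<tau>'" "\<tau>' i = Suc k"
        "agree b \<tau>' \<tau>" by auto
      moreover from this \<tau>(1) have "(psem B)\<^sup>*\<^sup>* (\<sigma>(i := 0)) \<tau>'" by (meson rtranclp.rtrancl_into_rtrancl)
      moreover from calculation \<tau>(3) have "agree b \<tau>' \<sigma>" by (simp add: agree_def)
      ultimately show ?case by blast
    qed
    then obtain \<rho> where \<rho>: "(psem B)\<^sup>*\<^sup>* (\<sigma>(i := 0)) \<rho>" "\<rho> i = n" "agree b \<rho> \<sigma>" by blast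
    have "recf_eval f (map \<rho> (i # xs)) 0"
      using n(1) \<rho>(2) agree_map[OF \<rho>(3) *(1)] by (simp del: map_eq_conv)
    from F2[OF this] obtain \<tau> where \<tau>: "psem Pf \<rho> \<tau>" "agree b' \<tau> (\<rho>(out := 0))" by blast
    then have "\<tau> i = n" "\<tau> out = 0" "agree b \<tau> \<sigma>" using \<rho> by (auto simp: agree_def defs)
    moreover from this \<tau>(1) \<rho>(1) have "psem P \<sigma> (\<tau>(r := \<tau> i))"
      unfolding P_def psem.simps OO_def mv psem_zero isem.simps by blast
    ultimately show "\<exists>\<tau>. psem P \<sigma> \<tau> \<and> agree b \<tau> (\<sigma>(r := n))"
      by (intro exI[of _ "\<tau>(r := n)"]) (auto simp: agree_def)
  qed
qed

lemma compilable: "compilable f"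
  by (induction f)
    (auto intro: compilable_Zero compilable_Succ compilable_Proj compilable_Comp compilable_PrimRec compilable_Mu)


section \<open>Control stacks\<close>

text \<open>
  A run is a sequence of single instructions; what remains to be done is a stack of programs.
  Administrative steps carry the trivial test \<open>TestEq 0 0\<close>.
\<close>

inductive cstep :: "prog list \<Rightarrow> instr \<Rightarrow> prog list \<Rightarrow> bool" where
  "cstep (Atom a # K) a K"
| "cstep (Seq P Q # K) (TestEq 0 0) (P # Q # K)"
| "cstep (Star P # K) (TestEq 0 0) K"
| "cstep (Star P # K) (TestEq 0 0) (P # Star P # K)"

inductive_cases cstepE: "cstep (Atom a # K) b K'" "cstep (Seq P Q # K) b K'" "cstep (Star P # K) b K'"
  "cstep [] b K'"

text \<open>A superset of the stacks that occur from \<open>P # K\<close> until \<open>K\<close>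
  itself is exposed. It is finite because a loop puts itself back unchanged, so a tile label can
  carry the whole stack.\<close>

primrec conts :: "prog \<Rightarrow> prog list \<Rightarrow> prog list set" where
  "conts (Atom a) K = {Atom a # K}"
| "conts (Seq P Q) K = {Seq P Q # K} \<union> conts P (Q # K) \<union> conts Q K"
| "conts (Star P) K = {Star P # K} \<union> conts P (Star P # K)"

lemma finite_conts: "finite (conts P K)"
  by (induction P arbitrary: K) auto

lemma self_in_conts: "P # K \<in> conts P K"
  by (cases P) auto

lemma conts_closed: "K1 \<in> conts P K \<Longrightarrow> cstep K1 a K2 \<Longrightarrow> K2 \<in> conts P K \<or> K2 = K"
proof (induction P arbitrary: K)
  case (Seq P Q)
  from Seq.prems(1) consider "K1 = Seq P Q # K" | "K1 \<in> conts P (Q # K)" | "K1 \<in> conts Q K" by auto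
  then show ?case
  proof cases
    case 1
    with Seq.prems(2) show ?thesis by (auto elim!: cstepE simp: self_in_conts)
  next
    case 2
    with Seq.IH(1)[OF 2 Seq.prems(2)] show ?thesis by (auto simp: self_in_conts)
  next
    case 3
    with Seq.IH(2)[OF _ Seq.prems(2)] show ?thesis by auto
  qed
next
  case (Star P)
  from Star.prems(1) consider "K1 = Star P # K" | "K1 \<in> conts P (Star P # K)" by auto
  then show ?case
  proof cases
    case 1
    with Star.prems(2) show ?thesis by (auto elim!: cstepE simp: self_in_conts)
  next
    case 2
    with Star.IH[OF _ Star.prems(2)] show ?thesis by (auto simp: self_in_conts)
  qed
qed (auto elim!: cstepE)

definition pstep :: "prog list \<times> (nat \<Rightarrow> nat) \<Rightarrow> prog list \<times> (nat \<Rightarrow> nat) \<Rightarrow> bool" where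
  "pstep = (\<lambda>(K, \<sigma>) (K', \<tau>). \<exists>a. cstep K a K' \<and> isem a \<sigma> \<tau>)"

definition ksem :: "prog list \<Rightarrow> (nat \<Rightarrow> nat) \<Rightarrow> (nat \<Rightarrow> nat) \<Rightarrow> bool" where
  "ksem K = foldr (\<lambda>P R. psem P OO R) K (=)"

lemma ksem_simps [simp]: "ksem [] = (=)" "ksem (P # K) = psem P OO ksem K"
  by (auto simp: ksem_def)

lemma ksem_cstep: "cstep K a K' \<Longrightarrow> isem a \<sigma> \<rho> \<Longrightarrow> ksem K' \<rho> \<tau> \<Longrightarrow> ksem K \<sigma> \<tau>"
  by (induction rule: cstep.induct) (auto simp: OO_def intro: converse_rtranclp_into_rtranclp)

lemma psteps_psem: "psem P \<sigma> \<tau> \<Longrightarrow> pstep\<^sup>*\<^sup>* (P # K, \<sigma>) (K, \<tau>)"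
proof (induction P arbitrary: K \<sigma> \<tau>)
  case (Atom a)
  then show ?case by (auto simp: pstep_def intro!: r_into_rtranclp cstep.intros)
next
  case (Seq P Q)
  then obtain \<rho> where "psem P \<sigma> \<rho>" "psem Q \<rho> \<tau>" by auto
  with Seq.IH have "pstep\<^sup>*\<^sup>* (P # Q # K, \<sigma>) (K, \<tau>)" by (meson rtranclp_trans)
  moreover have "pstep (Seq P Q # K, \<sigma>) (P # Q # K, \<sigma>)" by (auto simp: pstep_def intro: cstep.intros)
  ultimately show ?case by (rule converse_rtranclp_into_rtranclp[rotated])
next
  case (Star P)
  from Star.prems have "(psem P)\<^sup>*\<^sup>* \<sigma> \<tau>" by simp
  then show ?case
  proof (induction rule: converse_rtranclp_induct)
    case base
    show ?case by (auto simp: pstep_def intro!: r_into_rtranclp cstep.intros)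
  next
    case (step \<sigma> \<rho>)
    have "pstep (Star P # K, \<sigma>) (P # Star P # K, \<sigma>)" by (auto simp: pstep_def intro: cstep.intros)
    moreover have "pstep\<^sup>*\<^sup>* (P # Star P # K, \<sigma>) (Star P # K, \<rho>)" using Star.IH step by blast
    ultimately show ?case using step by (meson converse_rtranclp_into_rtranclp rtranclp_trans)
  qed
qed

text \<open>The run is read backwards from the empty stack, whose meaning is equality; each step
  extends the meaning of the new stack to that of the old one.\<close>

lemma psteps_ksem:
  assumes "pstep\<^sup>*\<^sup>* (K, \<sigma>) ([], \<tau>)"
  shows "ksem K \<sigma> \<tau>"
  using assms
  by (induction "(K, \<sigma>)" arbitrary: K \<sigma> rule: converse_rtranclp_induct)
    (auto simp: pstep_def intro: ksem_cstep)

lemma psem_iff_psteps: "psem P \<sigma> \<tau> \<longleftrightarrow> pstep\<^sup>*\<^sup>* ([P], \<sigma>) ([], \<tau>)"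
  using psteps_psem[of P \<sigma> \<tau> "[]"] psteps_ksem[of "[P]" \<sigma> \<tau>] by auto

section \<open>Closed patches of tiles\<close>

datatype dir = East | North | Long

text \<open>All vectors lie in the plane of the first two coordinates, so in higher dimension space
  splits into parallel planes without interaction. \<open>Long\<close> is parallel to
  \<open>East\<close>: an edge of this kind measures a distance within a row.\<close>

primrec vec :: "nat \<Rightarrow> nat \<Rightarrow> dir \<Rightarrow> int list" where
  "vec d m East = 1 # 0 # replicate (d - 2) 0"
| "vec d m North = 0 # 1 # replicate (d - 2) 0"
| "vec d m Long = int m # 0 # replicate (d - 2) 0"

definition shift :: "nat \<Rightarrow> nat \<Rightarrow> dir \<Rightarrow> int list \<Rightarrow> int list" where
  "shift d m v z = map2 (+) z (vec d m v)"

text \<open>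
  \<open>nout\<close> and \<open>nin\<close> prescribe in which directions a tile has a successor and a
  predecessor; \<open>vld\<close> relates a tile to its eastern and its northern neighbour.
\<close>

definition closed_patch ::
  "nat \<Rightarrow> nat \<Rightarrow> ('t \<Rightarrow> 't \<Rightarrow> 't \<Rightarrow> bool) \<Rightarrow> ('t \<Rightarrow> dir set) \<Rightarrow> ('t \<Rightarrow> dir set)
    \<Rightarrow> (int list \<Rightarrow> 't) \<Rightarrow> int list set \<Rightarrow> bool" where
  "closed_patch d m vld nout nin a Z \<longleftrightarrow>
     Z \<subseteq> cells d \<and> finite Z \<and> Z \<noteq> {} \<and>
     (\<forall>z\<in>Z. vld (a z) (a (shift d m East z)) (a (shift d m North z))) \<and>
     (\<forall>z\<in>cells d. \<forall>v. (z \<in> Z \<and> v \<in> nout (a z)) \<longleftrightarrow> (shift d m v z \<in> Z \<and> v \<in> nin (a (shift d m v z))))"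

lemma cells_eq:
  assumes "d \<ge> 2"
  shows "z \<in> cells d \<longleftrightarrow> (\<exists>x y r. z = x # y # r \<and> length r = d - 2)"
  using assms by (cases z; cases "tl z") (auto simp: cells_def)

lemma map2_add_zeros: "length r = n \<Longrightarrow> map2 (+) r (replicate n (0::int)) = r"
  by (rule nth_equalityI) auto

lemma shift_Cons:
  assumes "length r = d - 2"
  shows "shift d m East (x # y # r) = (x + 1) # y # r"
    "shift d m North (x # y # r) = x # (y + 1) # r"
    "shift d m Long (x # y # r) = (x + int m) # y # r"
  using assms by (simp_all add: shift_def map2_add_zeros)

section \<open>Space-time diagrams\<close>

text \<open>A number is written in a row as the column marked \<open>At\<close>. The tags on both
  sides of it turn uniqueness of the mark into a condition between horizontal neighbours.\<close>

datatype pos = Before | At | After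

definition pos_of :: "nat \<Rightarrow> nat \<Rightarrow> pos" where
  "pos_of x c = (if x < c then Before else if x = c then At else After)"

fun next_pos :: "pos \<Rightarrow> pos \<Rightarrow> bool" where
  "next_pos Before q \<longleftrightarrow> q \<noteq> After"
| "next_pos p q \<longleftrightarrow> q = After"

text \<open>The mark is the first column that is not \<open>Before\<close>. It exists by the
  condition at the right end. It cannot be \<open>After\<close>: not in column zero by the condition
  at the left end, and not later because \<open>After\<close> never follows \<open>Before\<close>
  directly.\<close>

lemma pos_sequence:
  assumes "c 0 \<noteq> After" "c W \<noteq> Before" "\<And>x. x < W \<Longrightarrow> next_pos (c x) (c (Suc x))"
  shows "\<exists>p\<le>W. \<forall>x\<le>W. c x = pos_of x p"
proof -
  define p where "p = (LEAST x. c x \<noteq> Before)"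
  have p: "c p \<noteq> Before" "p \<le> W"
    unfolding p_def using assms(2) by (rule LeastI, rule Least_le)
  have lt: "c x = Before" if "x < p" for x
    using that not_less_Least unfolding p_def by blast
  have "c p = At"
  proof (cases p)
    case 0
    then show ?thesis using p(1) assms(1) by (cases "c p") auto
  next
    case (Suc q)
    then show ?thesis using p assms(3)[of q] lt[of q] by (cases "c p") auto
  qed
  have gt: "c x = After" if "p < x" "x \<le> W" for x
    using that
  proof (induction x)
    case (Suc x)
    then have "c x = At \<or> c x = After" using \<open>c p = At\<close> by (cases "p = x") auto
    then show ?case using assms(3)[of x] Suc.prems by auto
  qed simp
  show ?thesis using p(2) \<open>c p = At\<close> lt gt
    by (intro exI[of _ p]) (auto simp: pos_of_def)
qed

text \<open>
  A row of tiles stores a state of a run: the label is the transition to the next row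
  (\<open>None\<close> in the last row), and \<open>rel\<close> compares the column with the registers.
\<close>

record tile =
  bot :: bool
  lft :: bool
  rgt :: bool
  lab :: "(prog list \<times> instr \<times> prog list) option"
  rel :: "nat \<Rightarrow> pos"

definition src :: "(prog list \<times> instr \<times> prog list) option \<Rightarrow> prog list" where
  "src l = (case l of None \<Rightarrow> [] | Some (K, a, K') \<Rightarrow> K)"

lemma src_simps [simp]: "src None = []" "src (Some (K, a, K')) = K"
  by (simp_all add: src_def)

definition transitions :: "prog \<Rightarrow> (prog list \<times> instr \<times> prog list) set" where
  "transitions P = {(K, a, K'). K \<in> conts P [] \<and> cstep K a K'}"

text \<open>Recording the tags of the first \<open>n\<close> registers only, as an extensional
  function, makes the set finite; \<open>n\<close> is later chosen above all registers of the
  program.\<close>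

definition tiles :: "prog \<Rightarrow> nat \<Rightarrow> tile set" where
  "tiles P n = {t. lab t \<in> insert None (Some ` transitions P) \<and> rel t \<in> {..<n} \<rightarrow>\<^sub>E UNIV}"

fun keeps :: "instr \<Rightarrow> nat \<Rightarrow> bool" where
  "keeps (Havoc i) j \<longleftrightarrow> j \<noteq> i"
| "keeps _ j \<longleftrightarrow> True"

text \<open>The test of a whole row is distributed over its columns: equal numbers have equal tags
  everywhere, a successor has its mark one column further east, and zero is marked at the left end.
  In the second case \<open>\<not> rgt t\<close> ensures that the eastern tile still belongs to the
  row.\<close>

fun tests :: "instr \<Rightarrow> tile \<Rightarrow> tile \<Rightarrow> bool" where
  "tests (Havoc i) t e \<longleftrightarrow> True"
| "tests (TestEq i j) t e \<longleftrightarrow> rel t i = rel t j"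
| "tests (TestSuc i j) t e \<longleftrightarrow> (rel t j = At \<longrightarrow> \<not> rgt t \<and> rel e i = At)"
| "tests (TestZero i) t e \<longleftrightarrow> (lft t \<longrightarrow> rel t i = At)"

text \<open>The eastern tile is constrained only if \<open>t\<close> is not a right end, and the
  northern one only if the label is not \<open>None\<close>. These are the cases in which
  \<open>tile_out\<close> demands such a successor inside the patch, so tiles outside a closed patch
  remain free.\<close>

definition tile_ok :: "prog \<Rightarrow> nat \<Rightarrow> tile \<Rightarrow> tile \<Rightarrow> tile \<Rightarrow> bool" where
  "tile_ok P n t e u \<longleftrightarrow>
     (\<not> rgt t \<longrightarrow> lab e = lab t \<and> bot e = bot t \<and> (\<forall>i<n. next_pos (rel t i) (rel e i))) \<and>
     (lft t \<longrightarrow> (\<forall>i<n. rel t i \<noteq> After)) \<and>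
     (rgt t \<longrightarrow> (\<forall>i<n. rel t i \<noteq> Before)) \<and>
     (bot t \<longrightarrow> src (lab t) = [P]) \<and>
     (\<forall>K a K'. lab t = Some (K, a, K') \<longrightarrow>
        src (lab u) = K' \<and> lft u = lft t \<and> rgt u = rgt t \<and> tests a t e \<and>
        (\<forall>j<n. keeps a j \<longrightarrow> rel u j = rel t j))"

text \<open>\<open>East\<close> edges run along a row and \<open>North\<close> edges join
  consecutive rows. The \<open>Long\<close> edge leads from the left end of the bottom row to the
  mark of register 0 in that row; this is how the length of the vector becomes the input.\<close>

definition tile_out :: "tile \<Rightarrow> dir set" where
  "tile_out t = {v. case v of East \<Rightarrow> \<not> rgt t | North \<Rightarrow> lab t \<noteq> None | Long \<Rightarrow> bot t \<and> lft t}"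

definition tile_in :: "tile \<Rightarrow> dir set" where
  "tile_in t = {v. case v of East \<Rightarrow> \<not> lft t | North \<Rightarrow> \<not> bot t | Long \<Rightarrow> bot t \<and> rel t 0 = At}"

abbreviation run_patch :: "nat \<Rightarrow> nat \<Rightarrow> prog \<Rightarrow> nat \<Rightarrow> (int list \<Rightarrow> tile) \<Rightarrow> int list set \<Rightarrow> bool" where
  "run_patch d m P n \<equiv> closed_patch d m (tile_ok P n) tile_out tile_in"

primrec instr_regs :: "instr \<Rightarrow> nat set" where
  "instr_regs (Havoc i) = {i}"
| "instr_regs (TestEq i j) = {i, j}"
| "instr_regs (TestSuc i j) = {i, j}"
| "instr_regs (TestZero i) = {i}"

primrec regs :: "prog \<Rightarrow> nat set" where
  "regs (Atom a) = instr_regs a"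
| "regs (Seq P Q) = regs P \<union> regs Q"
| "regs (Star P) = regs P"

lemma finite_regs: "finite (regs P)"
proof -
  have "finite (instr_regs a)" for a by (cases a) auto
  then show ?thesis by (induction P) auto
qed

text \<open>Register 0 is added for the administrative steps, whose test \<open>TestEq 0 0\<close>
  mentions it even if \<open>P\<close> does not.\<close>

lemma cstep_regs: "K1 \<in> conts P K \<Longrightarrow> cstep K1 a K2 \<Longrightarrow> instr_regs a \<subseteq> insert 0 (regs P)"
proof (induction P arbitrary: K)
  case (Seq P Q)
  then consider "K1 = Seq P Q # K" | "K1 \<in> conts P (Q # K)" | "K1 \<in> conts Q K" by auto
  then show ?case using Seq by cases (fastforce elim!: cstepE)+
next
  case (Star P)
  then consider "K1 = Star P # K" | "K1 \<in> conts P (Star P # K)" by auto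
  then show ?case using Star by cases (fastforce elim!: cstepE)+
qed (auto elim!: cstepE)

lemma finite_transitions: "finite (transitions P)"
proof -
  have fin: "finite {(a, K'). cstep K a K'}" for K
  proof (cases K)
    case Nil
    then have "{(a, K'). cstep K a K'} = {}" by (auto elim!: cstepE)
    then show ?thesis by simp
  next
    case (Cons Q L)
    show ?thesis
    proof (cases Q)
      case (Atom a)
      then have "{(a, K'). cstep K a K'} \<subseteq> {(a, L)}" using Cons by (auto elim!: cstepE)
      then show ?thesis by (rule finite_subset) simp
    next
      case (Seq P1 P2)
      then have "{(a, K'). cstep K a K'} \<subseteq> {(TestEq 0 0, P1 # P2 # L)}" using Cons by (auto elim!: cstepE)
      then show ?thesis by (rule finite_subset) simp
    next
      case (Star P)
      then have "{(a, K'). cstep K a K'} \<subseteq> {(TestEq 0 0, L), (TestEq 0 0, P # Star P # L)}"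
        using Cons by (auto elim!: cstepE)
      then show ?thesis by (rule finite_subset) simp
    qed
  qed
  have "transitions P = (SIGMA K:conts P []. {(a, K'). cstep K a K'})"
    by (auto simp: transitions_def)
  then show ?thesis using fin finite_conts by (simp add: finite_SigmaI)
qed

lemma finite_tiles: "finite (tiles P n)"
proof -
  have "(UNIV :: pos set) = {Before, At, After}" by (auto intro: pos.exhaust)
  then have "finite (UNIV :: pos set)" by (metis finite.emptyI finite.insertI)
  then have "finite ({..<n} \<rightarrow>\<^sub>E (UNIV :: pos set))" by (intro finite_PiE) auto
  then have fin: "finite ((UNIV :: (bool \<times> bool \<times> bool) set) \<times> insert None (Some ` transitions P) \<times> ({..<n} \<rightarrow>\<^sub>E (UNIV :: pos set)))"
    using finite_transitions by (intro finite_cartesian_product) auto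
  have "tiles P n \<subseteq> (\<lambda>((b, l, r), e, c). \<lparr>bot = b, lft = l, rgt = r, lab = e, rel = c\<rparr>) `
      ((UNIV :: (bool \<times> bool \<times> bool) set) \<times> insert None (Some ` transitions P) \<times> ({..<n} \<rightarrow>\<^sub>E UNIV))"
  proof
    fix t assume "t \<in> tiles P n"
    then show "t \<in> (\<lambda>((b, l, r), e, c). \<lparr>bot = b, lft = l, rgt = r, lab = e, rel = c\<rparr>) `
      ((UNIV :: (bool \<times> bool \<times> bool) set) \<times> insert None (Some ` transitions P) \<times> ({..<n} \<rightarrow>\<^sub>E UNIV))"
      by (intro image_eqI[of _ _ "((bot t, lft t, rgt t), lab t, rel t)"]) (auto simp: tiles_def)
  qed
  then show ?thesis using fin finite_surj by blast
qed

lemma tiles_nonempty: "tiles P n \<noteq> {}"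
proof -
  have "\<lparr>bot = True, lft = True, rgt = True, lab = None, rel = restrict (\<lambda>_. At) {..<n}\<rparr> \<in> tiles P n"
    by (auto simp: tiles_def)
  then show ?thesis by blast
qed


section \<open>Runs of a program versus closed patches\<close>

lemma closed_patch_of_run:
  assumes d: "d \<ge> 2" and n: "insert 0 (regs P) \<subseteq> {..<n}" and run: "psem P \<sigma> \<tau>" and m: "\<sigma> 0 = m"
  shows "\<exists>a Z. (\<forall>z. a z \<in> tiles P n) \<and> run_patch d m P n a Z"
proof -
  from run obtain T f where f0: "f 0 = ([P], \<sigma>)" and fT: "f T = ([], \<tau>)"
    and step: "\<And>j. j < T \<Longrightarrow> pstep (f j) (f (Suc j))"
    unfolding psem_iff_psteps rtranclp_power relpowp_fun_conv by blast
  define K where "K j = fst (f j)" for j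
  define s where "s j = snd (f j)" for j
  have K0: "K 0 = [P]" and s0: "s 0 = \<sigma>" and KT: "K T = []" by (simp_all add: K_def s_def f0 fT)
  have "\<forall>j. \<exists>a. j < T \<longrightarrow> cstep (K j) a (K (Suc j)) \<and> isem a (s j) (s (Suc j))"
    using step unfolding pstep_def K_def s_def split_beta by blast
  then obtain \<alpha> where \<alpha>: "\<And>j. j < T \<Longrightarrow> cstep (K j) (\<alpha> j) (K (Suc j))"
    "\<And>j. j < T \<Longrightarrow> isem (\<alpha> j) (s j) (s (Suc j))" by metis
  have Kc: "K j \<in> conts P [] \<or> K j = []" if "j \<le> T" for j
    using that
  proof (induction j)
    case 0
    show ?case by (simp add: K0 self_in_conts)
  next
    case (Suc j)
    then show ?case using \<alpha>(1)[of j] conts_closed[of "K j" P "[]"] by (auto elim!: cstepE)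
  qed
  have Kc': "K j \<in> conts P []" if "j < T" for j
    using that Kc[of j] \<alpha>(1)[OF that] by (auto elim!: cstepE)
  have an: "instr_regs (\<alpha> j) \<subseteq> {..<n}" if "j < T" for j
    using cstep_regs[OF Kc'[OF that] \<alpha>(1)[OF that]] n by auto
  \<comment> \<open>\<open>W\<close> bounds every register in every row, so all marks fit into the
    columns \<open>0\<close> to \<open>W\<close>; the sum of all values is one such bound.\<close>
  define W where "W = (\<Sum>j\<le>T. \<Sum>i<n. s j i)"
  have W: "s j i \<le> W" if "j \<le> T" "i < n" for i j
  proof -
    have "s j i \<le> (\<Sum>i<n. s j i)" using that by (intro member_le_sum) auto
    also have "\<dots> \<le> W" unfolding W_def using that by (intro member_le_sum) auto
    finally show ?thesis .
  qed
  define g where "g x y = \<lparr>bot = (y = 0), lft = (x = 0), rgt = (x = W),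
      lab = (if y < T then Some (K y, \<alpha> y, K (Suc y)) else None),
      rel = restrict (\<lambda>i. pos_of x (s y i)) {..<n}\<rparr>" for x y
  \<comment> \<open>Outside the rectangle the values are immaterial as long as they are tiles;
    \<open>nat\<close> clamps negative coordinates.\<close>
  define a where "a z = g (nat (z ! 0)) (nat (z ! 1))" for z :: "int list"
  define Z where "Z = (\<lambda>(x, y). int x # int y # replicate (d - 2) 0) ` ({..W} \<times> {..T})"
  have Z_iff: "x # y # r \<in> Z \<longleftrightarrow> 0 \<le> x \<and> x \<le> int W \<and> 0 \<le> y \<and> y \<le> int T \<and> r = replicate (d - 2) 0" for x y r
  proof
    show "x # y # r \<in> Z" if *: "0 \<le> x \<and> x \<le> int W \<and> 0 \<le> y \<and> y \<le> int T \<and> r = replicate (d - 2) 0"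
      unfolding Z_def by (rule image_eqI[of _ _ "(nat x, nat y)"]) (use * in auto)
  qed (auto simp: Z_def)
  have a_Cons: "a (x # y # r) = g (nat x) (nat y)" for x y r by (simp add: a_def)
  have "run_patch d m P n a Z"
    unfolding closed_patch_def
  proof (intro conjI ballI allI)
    show "Z \<subseteq> cells d" using d by (auto simp: Z_def cells_def)
    show "finite Z" by (simp add: Z_def)
    show "Z \<noteq> {}" by (auto simp: Z_def)
  next
    fix z assume "z \<in> Z"
    then obtain x y where z: "z = int x # int y # replicate (d - 2) 0" and xy: "x \<le> W" "y \<le> T"
      by (auto simp: Z_def)
    have sh: "a z = g x y" "a (shift d m East z) = g (Suc x) y" "a (shift d m North z) = g x (Suc y)"
      by (simp_all add: z a_Cons shift_Cons nat_add_distrib)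
    have *: "src (lab (g x (Suc y))) = K (Suc y)" if "y < T"
    proof (cases "Suc y < T")
      case False
      with that have "Suc y = T" by simp
      then show ?thesis using KT by (simp add: g_def)
    qed (simp add: g_def)
    have "tests (\<alpha> y) (g x y) (g (Suc x) y)" if y: "y < T"
    proof (cases "\<alpha> y")
      case (TestEq i j)
      with \<alpha>(2)[OF y] an[OF y] show ?thesis by (auto simp: g_def)
    next
      case (TestSuc i j)
      with \<alpha>(2)[OF y] an[OF y] W[OF xy(2), of i] show ?thesis by (auto simp: g_def pos_of_def)
    next
      case (TestZero i)
      with \<alpha>(2)[OF y] an[OF y] show ?thesis by (auto simp: g_def pos_of_def)
    qed simp
    moreover have "rel (g x (Suc y)) j = rel (g x y) j" if "y < T" "j < n" "keeps (\<alpha> y) j" for j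
      using that \<alpha>(2)[OF that(1)] by (cases "\<alpha> y") (auto simp: g_def)
    \<comment> \<open>Without a step the bottom row would be the last one, with the label
      \<open>None\<close> of source \<open>[]\<close> instead of \<open>[P]\<close>.\<close>
    moreover have "T \<noteq> 0" using K0 KT by (metis list.distinct(1))
    moreover have "\<forall>i<n. rel (g x y) i \<noteq> Before" if "x = W"
      using W[OF xy(2)] that by (auto simp: g_def pos_of_def leD)
    moreover have "\<forall>i<n. next_pos (rel (g x y) i) (rel (g (Suc x) y) i)"
      by (simp add: g_def pos_of_def)
    ultimately show "tile_ok P n (a z) (a (shift d m East z)) (a (shift d m North z))"
      unfolding sh tile_ok_def using * xy K0
      by (simp add: g_def) (simp add: pos_of_def)
  next
    fix z v assume "z \<in> cells d"
    then obtain x y r where z: "z = x # y # r" and r: "length r = d - 2" using cells_eq[OF d] by blast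
    have n0: "0 < n" using n by auto
    \<comment> \<open>The input is the initial value of register 0, so the long edge from the left
      end of the bottom row ends inside that row.\<close>
    have mW: "m \<le> W" using W[of 0 0] n0 by (simp add: s0 m)
    have out: "East \<in> tile_out (g i j) \<longleftrightarrow> i \<noteq> W" "North \<in> tile_out (g i j) \<longleftrightarrow> j < T"
      "Long \<in> tile_out (g i j) \<longleftrightarrow> j = 0 \<and> i = 0" for i j
      by (auto simp: tile_out_def g_def)
    have inn: "East \<in> tile_in (g i j) \<longleftrightarrow> i \<noteq> 0" "North \<in> tile_in (g i j) \<longleftrightarrow> j \<noteq> 0"
      "Long \<in> tile_in (g i j) \<longleftrightarrow> j = 0 \<and> i = m" for i j
      using n0 by (auto simp: tile_in_def g_def pos_of_def s0 m)
    show "(z \<in> Z \<and> v \<in> tile_out (a z)) = (shift d m v z \<in> Z \<and> v \<in> tile_in (a (shift d m v z)))"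
    proof (cases v)
      case East
      have "0 \<le> x \<and> x \<le> int W \<and> nat x \<noteq> W \<longleftrightarrow> 0 \<le> x + 1 \<and> x + 1 \<le> int W \<and> nat (x + 1) \<noteq> 0"
        by presburger
      then show ?thesis
        unfolding East z shift_Cons[OF r] Z_iff a_Cons out inn by blast
    next
      case North
      have "0 \<le> y \<and> y \<le> int T \<and> nat y < T \<longleftrightarrow> 0 \<le> y + 1 \<and> y + 1 \<le> int T \<and> nat (y + 1) \<noteq> 0"
        by presburger
      then show ?thesis
        unfolding North z shift_Cons[OF r] Z_iff a_Cons out inn by blast
    next
      case Long
      have "0 \<le> x \<and> x \<le> int W \<and> nat x = 0 \<longleftrightarrow>
          0 \<le> x + int m \<and> x + int m \<le> int W \<and> nat (x + int m) = m"
        using mW by presburger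
      then show ?thesis
        unfolding Long z shift_Cons[OF r] Z_iff a_Cons out inn by blast
    qed
  qed
  moreover have "a z \<in> tiles P n" for z
    unfolding a_def using Kc' \<alpha>(1) by (auto simp: tiles_def g_def transitions_def)
  ultimately show ?thesis by blast
qed


text \<open>A patch may consist of several pieces. One rectangle is isolated by starting from a
  bottom tile whose first coordinate is least in all of \<open>Z\<close>; finiteness stops the walks
  to the east and to the north, and the marks in the rows give the register values of a run. The
  choice of the start cell is also what forces the input to be \<open>m\<close>.\<close>

lemma run_of_closed_patch:
  assumes d: "d \<ge> 2" and n: "insert 0 (regs P) \<subseteq> {..<n}" and T: "\<forall>z\<in>cells d. a z \<in> tiles P n"
    and cp: "run_patch d m P n a Z"
  shows "\<exists>\<sigma> \<tau>. psem P \<sigma> \<tau> \<and> \<sigma> 0 = m"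
proof -
  have Zc: "Z \<subseteq> cells d" and fin: "finite Z" and ne: "Z \<noteq> {}"
    and ok: "\<And>z. z \<in> Z \<Longrightarrow> tile_ok P n (a z) (a (shift d m East z)) (a (shift d m North z))"
    and cl: "\<And>z v. z \<in> cells d \<Longrightarrow> (z \<in> Z \<and> v \<in> tile_out (a z)) \<longleftrightarrow>
      (shift d m v z \<in> Z \<and> v \<in> tile_in (a (shift d m v z)))"
    using cp unfolding closed_patch_def by blast+
  have cell: "x # y # r \<in> cells d" if "length r = d - 2" for x y r
    using that d by (simp add: cells_def)
  have cl_East: "(x # y # r \<in> Z \<and> \<not> rgt (a (x # y # r))) \<longleftrightarrow>
      ((x + 1) # y # r \<in> Z \<and> \<not> lft (a ((x + 1) # y # r)))" if "length r = d - 2" for x y r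
    using cl[OF cell[OF that], of x y East] shift_Cons[OF that] by (simp add: tile_out_def tile_in_def)
  have cl_North: "(x # y # r \<in> Z \<and> lab (a (x # y # r)) \<noteq> None) \<longleftrightarrow>
      (x # (y + 1) # r \<in> Z \<and> \<not> bot (a (x # (y + 1) # r)))" if "length r = d - 2" for x y r
    using cl[OF cell[OF that], of x y North] shift_Cons[OF that] by (simp add: tile_out_def tile_in_def)
  have cl_Long: "(x # y # r \<in> Z \<and> bot (a (x # y # r)) \<and> lft (a (x # y # r))) \<longleftrightarrow>
      ((x + int m) # y # r \<in> Z \<and> bot (a ((x + int m) # y # r)) \<and> rel (a ((x + int m) # y # r)) 0 = At)"
      if "length r = d - 2" for x y r
    using cl[OF cell[OF that], of x y Long] shift_Cons[OF that] by (simp add: tile_out_def tile_in_def)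
  have ok': "tile_ok P n (a (x # y # r)) (a ((x + 1) # y # r)) (a (x # (y + 1) # r))"
    if "x # y # r \<in> Z" "length r = d - 2" for x y r
    using ok[OF that(1)] shift_Cons[OF that(2)] by simp
  have split: "\<exists>x y r. z = x # y # r \<and> length r = d - 2" if "z \<in> Z" for z
    using that Zc cells_eq[OF d] by blast
  define Z0 where "Z0 = {z \<in> Z. bot (a z)}"
  \<comment> \<open>A cell of least second coordinate has no cell of \<open>Z\<close> below it, so
    by closedness its tile cannot ask for a northward predecessor and must be a bottom tile.\<close>
  have "Z0 \<noteq> {}"
  proof -
    obtain z where z: "z \<in> Z" "\<And>w. w \<in> Z \<Longrightarrow> z ! 1 \<le> w ! 1"
      using ex_min_if_finite[of "(\<lambda>z. z ! 1) ` Z"] fin ne by (auto simp: not_less)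
    obtain x y r where zeq: "z = x # y # r" and r: "length r = d - 2" using split[OF z(1)] by blast
    have "x # (y - 1) # r \<notin> Z" using z(2)[of "x # (y - 1) # r"] by (auto simp: zeq)
    with cl_North[OF r, of x "y - 1"] z(1) have "bot (a z)" by (simp add: zeq)
    with z(1) show ?thesis by (auto simp: Z0_def)
  qed
  then obtain z where z: "z \<in> Z0" "\<And>w. w \<in> Z0 \<Longrightarrow> z ! 0 \<le> w ! 0"
    using ex_min_if_finite[of "(\<lambda>z. z ! 0) ` Z0"] fin by (auto simp: not_less Z0_def)
  then obtain x1 y1 r where zeq: "z = x1 # y1 # r" and r: "length r = d - 2"
    using split[of z] by (auto simp: Z0_def)
  define C where "C i j = (x1 + int i) # (y1 + int j) # r" for i j
  have CE: "(C i j \<in> Z \<and> \<not> rgt (a (C i j))) \<longleftrightarrow> (C (Suc i) j \<in> Z \<and> \<not> lft (a (C (Suc i) j)))" for i j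
    using cl_East[OF r, of "x1 + int i" "y1 + int j"] by (simp add: C_def algebra_simps)
  have CN: "(C i j \<in> Z \<and> lab (a (C i j)) \<noteq> None) \<longleftrightarrow> (C i (Suc j) \<in> Z \<and> \<not> bot (a (C i (Suc j))))" for i j
    using cl_North[OF r, of "x1 + int i" "y1 + int j"] by (simp add: C_def algebra_simps)
  have Cok: "tile_ok P n (a (C i j)) (a (C (Suc i) j)) (a (C i (Suc j)))" if "C i j \<in> Z" for i j
    using ok'[OF that[unfolded C_def] r] by (simp add: C_def algebra_simps)
  have C00: "C 0 0 \<in> Z" "bot (a (C 0 0))" using z(1) by (auto simp: Z0_def zeq C_def)
  have left: "lft (a (C 0 0))"
  proof (rule ccontr)
    let ?w = "(x1 - 1) # y1 # r"
    assume "\<not> lft (a (C 0 0))"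
    with cl_East[OF r, of "x1 - 1" y1] C00 have w: "?w \<in> Z" "\<not> rgt (a ?w)" by (auto simp: C_def)
    with ok'[OF w(1) r] C00 have "bot (a ?w)" by (auto simp: tile_ok_def C_def)
    with w z(2)[of ?w] show False by (auto simp: Z0_def zeq)
  qed
  \<comment> \<open>An injective infinite walk inside \<open>Z\<close> contradicts finiteness; this
    ends the row on the right and the diagram at the top.\<close>
  have inf: "\<not> (\<forall>i. C (f i) (g i) \<in> Z)" if "inj (\<lambda>i. (f i, g i))" for f g :: "nat \<Rightarrow> nat"
  proof
    assume "\<forall>i. C (f i) (g i) \<in> Z"
    then have "range (\<lambda>i. C (f i) (g i)) \<subseteq> Z" by auto
    then have "finite (range (\<lambda>i. C (f i) (g i)))" using fin by (rule finite_subset)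
    moreover have "inj (\<lambda>i. C (f i) (g i))"
      by (rule injI, rule injD[OF that]) (simp add: C_def)
    ultimately show False using finite_imageD infinite_UNIV_nat by blast
  qed
  have "\<exists>W. C W 0 \<in> Z \<and> rgt (a (C W 0))"
  proof (rule ccontr)
    assume *: "\<not> ?thesis"
    have "C i 0 \<in> Z" for i using C00 CE * by (induction i) auto
    then show False using inf[of "\<lambda>i. i" "\<lambda>i. 0"] by (auto simp: inj_def)
  qed
  then obtain W where W: "C W 0 \<in> Z" "rgt (a (C W 0))"
    and Wmin: "\<And>i. i < W \<Longrightarrow> \<not> (C i 0 \<in> Z \<and> rgt (a (C i 0)))"
    using exists_least_iff[of "\<lambda>W. C W 0 \<in> Z \<and> rgt (a (C W 0))"] by auto
  define row where "row j \<longleftrightarrow> (\<forall>i\<le>W. C i j \<in> Z \<and> rgt (a (C i j)) = (i = W) \<and> lft (a (C i j)) = (i = 0) \<and>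
      lab (a (C i j)) = lab (a (C 0 j)))" for j
  have row0: "C i 0 \<in> Z \<and> rgt (a (C i 0)) = (i = W) \<and> lft (a (C i 0)) = (i = 0) \<and>
      lab (a (C i 0)) = lab (a (C 0 0)) \<and> bot (a (C i 0))" if "i \<le> W" for i
    using that
  proof (induction i)
    case 0
    show ?case using C00 left W(2) Wmin[of 0] by (cases "W = 0") auto
  next
    case (Suc i)
    then have i: "C i 0 \<in> Z" "\<not> rgt (a (C i 0))" "lab (a (C i 0)) = lab (a (C 0 0))" "bot (a (C i 0))" by auto
    with CE[of i 0] have "C (Suc i) 0 \<in> Z" "\<not> lft (a (C (Suc i) 0))" by auto
    moreover have "lab (a (C (Suc i) 0)) = lab (a (C i 0))" "bot (a (C (Suc i) 0))"
      using Cok[OF i(1)] i by (auto simp: tile_ok_def)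
    ultimately show ?case using i Suc.prems W(2) Wmin[of "Suc i"] by (cases "Suc i = W") auto
  qed
  then have r0: "row 0" unfolding row_def by blast
  have row_Suc: "row (Suc j)" if "row j" and nn: "lab (a (C 0 j)) \<noteq> None" for j
  proof -
    obtain K \<alpha> K' where l: "lab (a (C 0 j)) = Some (K, \<alpha>, K')"
      using nn by (metis not_None_eq prod_cases3)
    have l': "lab (a (C i j)) = Some (K, \<alpha>, K')" "C i j \<in> Z" if "i \<le> W" for i
      using that \<open>row j\<close> l by (auto simp: row_def)
    have up: "C i (Suc j) \<in> Z" "rgt (a (C i (Suc j))) = (i = W)" "lft (a (C i (Suc j))) = (i = 0)" if i: "i \<le> W" for i
    proof -
      show "C i (Suc j) \<in> Z" using CN[of i j] l'[OF i] by simp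
      have "rgt (a (C i j)) = (i = W)" "lft (a (C i j)) = (i = 0)"
        using \<open>row j\<close> i unfolding row_def by blast+
      moreover have "lft (a (C i (Suc j))) = lft (a (C i j)) \<and> rgt (a (C i (Suc j))) = rgt (a (C i j))"
        using Cok[OF l'(2)[OF i]] l'(1)[OF i] unfolding tile_ok_def by blast
      ultimately show "rgt (a (C i (Suc j))) = (i = W)" "lft (a (C i (Suc j))) = (i = 0)" by simp_all
    qed
    have "lab (a (C i (Suc j))) = lab (a (C 0 (Suc j)))" if "i \<le> W" for i
      using that
    proof (induction i)
      case (Suc i)
      then have "\<not> rgt (a (C i (Suc j)))" using up(2)[of i] by simp
      then have "lab (a (C (Suc i) (Suc j))) = lab (a (C i (Suc j)))"
        using Cok[OF up(1)[of i]] Suc.prems unfolding tile_ok_def by simp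
      then show ?case using Suc by simp
    qed simp
    with up show ?thesis unfolding row_def by blast
  qed
  have "\<exists>t. row t \<and> lab (a (C 0 t)) = None"
  proof (rule ccontr)
    assume *: "\<not> ?thesis"
    have "row j" for j using r0 row_Suc * by (induction j) auto
    then have "C 0 j \<in> Z" for j by (auto simp: row_def)
    then show False using inf[of "\<lambda>i. 0" "\<lambda>i. i"] by (auto simp: inj_def)
  qed
  then obtain t where t: "lab (a (C 0 t)) = None"
    and tmin: "\<And>j. j < t \<Longrightarrow> \<not> (row j \<and> lab (a (C 0 j)) = None)"
    using exists_least_iff[of "\<lambda>t. row t \<and> lab (a (C 0 t)) = None"] by auto
  have rows: "row j" if "j \<le> t" for j
    using that by (induction j) (use r0 row_Suc tmin in auto)
  have "\<exists>p\<le>W. \<forall>x\<le>W. rel (a (C x j)) i = pos_of x p" if "j \<le> t" "i < n" for i j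
  proof (rule pos_sequence[of "\<lambda>x. rel (a (C x j)) i"])
    have *: "C x j \<in> Z" "rgt (a (C x j)) = (x = W)" "lft (a (C x j)) = (x = 0)" if "x \<le> W" for x
      using rows[OF \<open>j \<le> t\<close>] that by (auto simp: row_def)
    show "rel (a (C 0 j)) i \<noteq> After" "rel (a (C W j)) i \<noteq> Before"
      using Cok[OF *(1)[of 0]] Cok[OF *(1)[of W]] *(2)[of W] *(3)[of 0] \<open>i < n\<close> by (auto simp: tile_ok_def)
    show "next_pos (rel (a (C x j)) i) (rel (a (C (Suc x) j)) i)" if "x < W" for x
      using Cok[OF *(1)[of x]] *(2)[of x] that \<open>i < n\<close> by (auto simp: tile_ok_def)
  qed
  then obtain p where p: "\<And>i j. j \<le> t \<Longrightarrow> i < n \<Longrightarrow> p j i \<le> W"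
    "\<And>i j x. j \<le> t \<Longrightarrow> i < n \<Longrightarrow> x \<le> W \<Longrightarrow> rel (a (C x j)) i = pos_of x (p j i)" by metis
  \<comment> \<open>Registers from \<open>n\<close> on do not occur in the program. A constant value
    keeps them equal in all rows, which matters because \<open>isem\<close> compares complete
    states.\<close>
  define s where "s j i = (if i < n then p j i else 0)" for j i
  have s: "s j i \<le> W" "x \<le> W \<Longrightarrow> rel (a (C x j)) i = pos_of x (s j i)" if "j \<le> t" "i < n" for i j x
    using p that by (auto simp: s_def)
  have posAt: "pos_of x y = At \<longleftrightarrow> x = y" for x y by (simp add: pos_of_def)
  have step: "pstep (src (lab (a (C 0 j))), s j) (src (lab (a (C 0 (Suc j)))), s (Suc j))" if j: "j < t" for j
  proof -
    have rj: "row j" using rows j by simp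
    obtain K \<alpha> K' where l: "lab (a (C 0 j)) = Some (K, \<alpha>, K')"
      using tmin[OF j] rj by (metis not_None_eq prod_cases3)
    have "C 0 j \<in> Z" using rj by (auto simp: row_def)
    with T Zc l have "(K, \<alpha>, K') \<in> transitions P" by (force simp: tiles_def)
    then have cs: "cstep K \<alpha> K'" and areg: "instr_regs \<alpha> \<subseteq> {..<n}"
      using cstep_regs n by (fastforce simp: transitions_def)+
    have x: "C x j \<in> Z" "rgt (a (C x j)) = (x = W)" "lft (a (C x j)) = (x = 0)"
        "lab (a (C x j)) = Some (K, \<alpha>, K')" if "x \<le> W" for x
      using rj that l by (auto simp: row_def)
    have tk: "tests \<alpha> (a (C x j)) (a (C (Suc x) j))"
      "\<And>i. i < n \<Longrightarrow> keeps \<alpha> i \<Longrightarrow> rel (a (C x (Suc j))) i = rel (a (C x j)) i"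
      "src (lab (a (C x (Suc j)))) = K'" if "x \<le> W" for x
      using Cok[OF x(1)[OF that]] x(4)[OF that] by (auto simp: tile_ok_def)
    \<comment> \<open>It suffices to look at the column that carries the mark of \<open>i\<close> in
      row \<open>j\<close>: its tag is the same one row above.\<close>
    have keep: "s (Suc j) i = s j i" if "keeps \<alpha> i" for i
    proof (cases "i < n")
      case True
      have "rel (a (C (s j i) (Suc j))) i = rel (a (C (s j i) j)) i"
        using tk(2)[OF s(1)[OF _ True, of j] True that] j by simp
      then have "pos_of (s j i) (s (Suc j) i) = At"
        using s(2)[of j i "s j i"] s(2)[of "Suc j" i "s j i"] s(1)[of j i] True j by (simp add: posAt)
      then show ?thesis by (simp add: posAt)
    qed (simp add: s_def)
    have "isem \<alpha> (s j) (s (Suc j))"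
    proof (cases \<alpha>)
      case (Havoc i)
      then have "s (Suc j) = (s j)(i := s (Suc j) i)" using keep by auto
      then show ?thesis using Havoc by auto
    next
      case (TestEq i k)
      then have ik: "i < n" "k < n" and eq: "s (Suc j) = s j" using areg keep by auto
      have "pos_of (s j i) (s j i) = pos_of (s j i) (s j k)"
        using tk(1)[of "s j i"] TestEq s(1)[of j i] s(2)[of j i "s j i"] s(2)[of j k "s j i"] ik j by auto
      then have "s j i = s j k" by (metis posAt)
      then show ?thesis using TestEq eq by simp
    next
      case (TestSuc i k)
      then have ik: "i < n" "k < n" and eq: "s (Suc j) = s j" using areg keep by auto
      have k: "s j k \<le> W" "rel (a (C (s j k) j)) k = At" using s ik j by (simp_all add: posAt)
      then have *: "s j k \<noteq> W" "rel (a (C (Suc (s j k)) j)) i = At"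
        using tk(1)[of "s j k"] TestSuc x(2)[of "s j k"] by auto
      then have "pos_of (Suc (s j k)) (s j i) = At" using s(2)[of j i "Suc (s j k)"] ik j k(1) by simp
      then show ?thesis using TestSuc eq by (simp add: posAt)
    next
      case (TestZero i)
      then have i: "i < n" and eq: "s (Suc j) = s j" using areg keep by auto
      have "pos_of 0 (s j i) = At" using tk(1)[of 0] TestZero x(3)[of 0] s(2)[of j i 0] i j by auto
      then show ?thesis using TestZero eq by (simp add: posAt)
    qed
    with cs show ?thesis using l tk(3)[of 0] by (auto simp: pstep_def)
  qed
  have "pstep\<^sup>*\<^sup>* (src (lab (a (C 0 0))), s 0) (src (lab (a (C 0 j))), s j)" if "j \<le> t" for j
    using that
  proof (induction j)
    case (Suc j)
    then show ?case using step[of j] by (meson Suc_leD Suc_le_lessD rtranclp.rtrancl_into_rtrancl)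
  qed simp
  from this[of t] have "pstep\<^sup>*\<^sup>* ([P], s 0) ([], s t)"
    using t Cok[OF C00(1)] C00(2) by (auto simp: tile_ok_def)
  then have "psem P (s 0) (s t)" by (simp add: psem_iff_psteps)
  moreover have "s 0 0 = m"
  proof -
    \<comment> \<open>\<open>?w\<close> is the tail of the long edge that enters the mark of
      register 0. It is itself a bottom tile, so minimality of the start cell gives
      \<open>m \<le> ?p\<close> and places \<open>?w\<close> in the same row; being a left end, it
      must be column zero.\<close>
    let ?p = "s 0 0" and ?w = "(x1 + int (s 0 0) - int m) # y1 # r"
    have n0: "0 < n" using n by auto
    have "?p \<le> W" "rel (a (C ?p 0)) 0 = At" using s[of 0 0] n0 by (simp_all add: posAt)
    moreover from this row0[of ?p] have "C ?p 0 \<in> Z" "bot (a (C ?p 0))" by auto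
    ultimately have w: "?w \<in> Z" "bot (a ?w)" "lft (a ?w)"
      using cl_Long[OF r, of "x1 + int ?p - int m" y1] by (auto simp: C_def)
    then have "m \<le> ?p" using z(2)[of ?w] by (auto simp: Z0_def zeq)
    then have "?w = C (?p - m) 0" by (simp add: C_def of_nat_diff algebra_simps)
    with w row0[of "?p - m"] \<open>?p \<le> W\<close> have "?p - m = 0" by auto
    with \<open>m \<le> ?p\<close> show ?thesis by simp
  qed
  ultimately show ?thesis by blast
qed

section \<open>Parity systems\<close>

text \<open>Over the field with two elements, symmetric difference is addition of vectors and the
  parity of the intersection with \<open>F\<close> is a linear functional.\<close>

lemma odd_card_sym_diff:
  assumes "finite F"
  shows "odd (card (F \<inter> sym_diff H B)) \<longleftrightarrow> odd (card (F \<inter> H)) \<noteq> odd (card (F \<inter> B))"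
proof -
  have "card (F \<inter> H) = card (F \<inter> (H - B)) + card (F \<inter> (H \<inter> B))"
    "card (F \<inter> B) = card (F \<inter> (B - H)) + card (F \<inter> (H \<inter> B))"
    "card (F \<inter> sym_diff H B) = card (F \<inter> (H - B)) + card (F \<inter> (B - H))"
    using assms by (subst card_Un_disjoint[symmetric]; auto intro!: arg_cong[where f=card])+
  then show ?thesis by auto
qed

text \<open>
  Elimination of one unknown \<open>y\<close> that occurs in a single equation \<open>z\<close> of the system.
\<close>

lemma parity_system_finite:
  fixes S :: "'z \<Rightarrow> 'y set"
  assumes "finite J" and fin: "\<And>z. z \<in> J \<Longrightarrow> finite (S z)"
    and priv: "\<And>Z. Z \<subseteq> J \<Longrightarrow> Z \<noteq> {} \<Longrightarrow> \<exists>z\<in>Z. \<exists>y\<in>S z. \<forall>z'\<in>Z - {z}. y \<notin> S z'"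
  shows "\<exists>B. \<forall>z\<in>J. odd (card (S z \<inter> B)) \<longleftrightarrow> \<delta> z"
  using assms
proof (induction J rule: finite_psubset_induct)
  case (psubset J)
  show ?case
  proof (cases "J = {}")
    case False
    from psubset.prems(2)[OF order_refl False] obtain z y where zy: "z \<in> J" "y \<in> S z"
      "\<forall>z'\<in>J - {z}. y \<notin> S z'" by blast
    have "\<exists>B. \<forall>w\<in>J - {z}. odd (card (S w \<inter> B)) \<longleftrightarrow> \<delta> w"
    proof (rule psubset.IH)
      show "J - {z} \<subset> J" using zy(1) by blast
      show "finite (S w)" if "w \<in> J - {z}" for w using that psubset.prems(1) by blast
      show "\<exists>z\<in>Z. \<exists>y\<in>S z. \<forall>z'\<in>Z - {z}. y \<notin> S z'" if "Z \<subseteq> J - {z}" "Z \<noteq> {}" for Z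
        using that psubset.prems(2)[of Z] by blast
    qed
    then obtain B where B: "\<forall>w\<in>J - {z}. odd (card (S w \<inter> B)) \<longleftrightarrow> \<delta> w" by blast
    show ?thesis
    proof (cases "odd (card (S z \<inter> B)) \<longleftrightarrow> \<delta> z")
      case True
      with B show ?thesis by blast
    next
      case False
      \<comment> \<open>Toggling \<open>y\<close> corrects the equation of \<open>z\<close> and
        leaves all others as they are.\<close>
      have "odd (card (S w \<inter> sym_diff B {y})) \<longleftrightarrow> \<delta> w" if "w \<in> J" for w
      proof (cases "w = z")
        case True
        have "S z \<inter> {y} = {y}" using zy by auto
        with True False show ?thesis using odd_card_sym_diff[of "S z" B "{y}"] psubset.prems(1) zy by simp
      next
        case w: False
        then have "S w \<inter> {y} = {}" using zy that by auto
        then show ?thesis using odd_card_sym_diff[of "S w" B "{y}"] psubset.prems(1) that B w by simp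
      qed
      then show ?thesis by blast
    qed
  qed auto
qed

text \<open>Each equation involves finitely many unknowns, so its solution set is closed in the
  compact product space of all boolean assignments. Solvability of finite subsystems is then the
  finite intersection property.\<close>

lemma parity_system_compact:
  fixes S :: "'z \<Rightarrow> 'y set"
  assumes fin: "\<And>z. z \<in> I \<Longrightarrow> finite (S z)"
    and solv: "\<And>J. finite J \<Longrightarrow> J \<subseteq> I \<Longrightarrow> \<exists>B. \<forall>z\<in>J. odd (card (S z \<inter> B)) \<longleftrightarrow> \<delta> z"
  shows "\<exists>B. \<forall>z\<in>I. odd (card (S z \<inter> B)) \<longleftrightarrow> \<delta> z"
proof -
  define X where "X = product_topology (\<lambda>_::'y. discrete_topology (UNIV :: bool set)) UNIV"
  have top: "topspace X = UNIV" by (simp add: X_def)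
  have comp: "compact_space X"
    unfolding X_def by (simp add: compact_space_product_topology compact_space_discrete_topology)
  have point: "openin X {f. f y = b}" for y b
  proof -
    have "openin X {f \<in> topspace X. f y \<in> {b}}"
      by (rule openin_continuous_map_preimage[of _ "discrete_topology UNIV"])
        (auto simp: X_def intro: continuous_map_product_projection)
    then show ?thesis by (simp add: top)
  qed
  have cyl: "openin X {f. \<forall>y\<in>F. f y = (y \<in> T)}" if "finite F" for F T
    using that
  proof (induction F rule: finite_induct)
    case empty
    show ?case using openin_topspace[of X] by (simp add: top)
  next
    case (insert y F)
    have eq: "{f. \<forall>x\<in>insert y F. f x = (x \<in> T)} = {f. f y = (y \<in> T)} \<inter> {f. \<forall>x\<in>F. f x = (x \<in> T)}" by auto
    show ?case unfolding eq by (rule openin_Int[OF point insert.IH])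
  qed
  define C where "C z b = {f. odd (card (S z \<inter> Collect f)) = b}" for z b
  have "openin X (C z b)" if "z \<in> I" for z b
  proof -
    have "C z b = (\<Union>T\<in>{T. T \<subseteq> S z \<and> odd (card T) = b}. {f. \<forall>y\<in>S z. f y = (y \<in> T)})"
    proof (intro set_eqI iffI)
      fix f assume "f \<in> C z b"
      then show "f \<in> (\<Union>T\<in>{T. T \<subseteq> S z \<and> odd (card T) = b}. {f. \<forall>y\<in>S z. f y = (y \<in> T)})"
        unfolding C_def by (intro UN_I[of "S z \<inter> Collect f"]) auto
    next
      fix f assume "f \<in> (\<Union>T\<in>{T. T \<subseteq> S z \<and> odd (card T) = b}. {f. \<forall>y\<in>S z. f y = (y \<in> T)})"
      then obtain T where T: "T \<subseteq> S z" "odd (card T) = b" "\<forall>y\<in>S z. f y = (y \<in> T)" by blast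
      then have "S z \<inter> Collect f = T" by auto
      with T show "f \<in> C z b" by (simp add: C_def)
    qed
    moreover have "openin X (\<Union>T\<in>{T. T \<subseteq> S z \<and> odd (card T) = b}. {f. \<forall>y\<in>S z. f y = (y \<in> T)})"
      by (rule openin_Union) (use cyl[OF fin[OF that]] in auto)
    ultimately show ?thesis by simp
  qed
  \<comment> \<open>The complement is the solution set for the opposite right-hand side, so openness
    for both values of \<open>b\<close> yields closedness.\<close>
  moreover have "UNIV - C z b = C z (\<not> b)" for z b by (auto simp: C_def)
  ultimately have closed: "closedin X (C z b)" if "z \<in> I" for z b
    using that by (simp add: closedin_def top)
  define \<U> where "\<U> = (\<lambda>z. C z (\<delta> z)) ` I"
  have "\<Inter>\<U> \<noteq> {}"
  proof (rule comp[unfolded compact_space_fip, rule_format])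
    show "(\<forall>C\<in>\<U>. closedin X C) \<and> (\<forall>\<F>. finite \<F> \<and> \<F> \<subseteq> \<U> \<longrightarrow> \<Inter>\<F> \<noteq> {})"
    proof (intro conjI ballI allI impI)
      fix D assume "D \<in> \<U>"
      then show "closedin X D" using closed by (auto simp: \<U>_def)
    next
      fix \<F> assume "finite \<F> \<and> \<F> \<subseteq> \<U>"
      then have F: "finite \<F>" "\<F> \<subseteq> \<U>" by blast+
      obtain J where J: "J \<subseteq> I" "finite J" "\<F> = (\<lambda>z. C z (\<delta> z)) ` J"
        using finite_subset_image[OF F(1) F(2)[unfolded \<U>_def]] by blast
      from solv[OF J(2,1)] obtain B where "\<forall>z\<in>J. odd (card (S z \<inter> B)) \<longleftrightarrow> \<delta> z" by blast
      then have "(\<lambda>y. y \<in> B) \<in> \<Inter>\<F>" by (auto simp: J C_def)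
      then show "\<Inter>\<F> \<noteq> {}" by blast
    qed
  qed
  then obtain f where "f \<in> \<Inter>\<U>" by blast
  then have "\<forall>z\<in>I. odd (card (S z \<inter> Collect f)) \<longleftrightarrow> \<delta> z" by (auto simp: \<U>_def C_def)
  then show ?thesis by blast
qed

section \<open>Uniform product measures\<close>

text \<open>It is enough to compare both measures on cylinders, where each factor is preserved
  separately. The lemma serves on two levels: for the cells of one random configuration and for the
  two time steps.\<close>

lemma distr_PiM_components:
  assumes M: "\<And>i. i \<in> I \<Longrightarrow> prob_space (M i)"
    and f: "\<And>i. i \<in> I \<Longrightarrow> f i \<in> measurable (M i) (M i)"
    and inv: "\<And>i. i \<in> I \<Longrightarrow> distr (M i) (M i) (f i) = M i"
  shows "(\<lambda>x. \<lambda>i\<in>I. f i (x i)) \<in> measurable (PiM I M) (PiM I M)"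
    and "distr (PiM I M) (PiM I M) (\<lambda>x. \<lambda>i\<in>I. f i (x i)) = PiM I M"
proof -
  let ?F = "\<lambda>x. \<lambda>i\<in>I. f i (x i)"
  show meas: "?F \<in> measurable (PiM I M) (PiM I M)"
    by (rule measurable_restrict) (use f in \<open>auto intro: measurable_compose[OF measurable_component_singleton]\<close>)
  show "distr (PiM I M) (PiM I M) ?F = PiM I M"
  proof (rule measure_eqI_PiM_infinite[symmetric, OF refl])
    interpret prob_space "PiM I M" using M by (rule prob_space_PiM)
    show "finite_measure (PiM I M)" by unfold_locales
    fix A J assume J: "finite J" "J \<subseteq> I" and A: "\<And>i. i \<in> J \<Longrightarrow> A i \<in> sets (M i)"
    let ?B = "\<lambda>i. f i -` A i \<inter> space (M i)"
    have B: "?B i \<in> sets (M i)" if "i \<in> J" for i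
      using measurable_sets[OF f A] that J by blast
    have "PiM I M (prod_emb I M J (Pi\<^sub>E J A)) = (\<Prod>i\<in>J. M i (A i))"
      by (intro emeasure_PiM_emb M J A)
    also have "\<dots> = (\<Prod>i\<in>J. M i (?B i))"
    proof (rule prod.cong[OF refl])
      fix i assume "i \<in> J"
      then have "M i (A i) = distr (M i) (M i) (f i) (A i)" using inv J by auto
      also have "\<dots> = M i (?B i)" using \<open>i \<in> J\<close> J by (intro emeasure_distr f A) auto
      finally show "M i (A i) = M i (?B i)" .
    qed
    also have "\<dots> = PiM I M (prod_emb I M J (Pi\<^sub>E J ?B))"
      by (intro emeasure_PiM_emb[symmetric] M J B)
    also have "prod_emb I M J (Pi\<^sub>E J ?B) = ?F -` prod_emb I M J (Pi\<^sub>E J A) \<inter> space (PiM I M)"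
    proof -
      have "f i x \<in> space (M i)" if "i \<in> I" "x \<in> space (M i)" for i x
        using f[OF that(1)] that(2) by (auto simp: measurable_def)
      with J show ?thesis by (auto simp: prod_emb_def space_PiM PiE_iff subset_eq)
    qed
    also have "PiM I M \<dots> = distr (PiM I M) (PiM I M) ?F (prod_emb I M J (Pi\<^sub>E J A))"
      using J A by (intro emeasure_distr[symmetric] meas sets_PiM_I) auto
    finally show "PiM I M (prod_emb I M J (Pi\<^sub>E J A)) = distr (PiM I M) (PiM I M) ?F (prod_emb I M J (Pi\<^sub>E J A))" .
  qed simp
qed

lemma distr_uniform_count_measure_bij:
  assumes "finite A" "bij_betw p A A"
  shows "p \<in> measurable (uniform_count_measure A) (uniform_count_measure A)"
    and "distr (uniform_count_measure A) (uniform_count_measure A) p = uniform_count_measure A"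
proof -
  have p: "p \<in> A \<rightarrow> A" using assms(2) by (rule bij_betw_imp_funcset)
  then show meas: "p \<in> measurable (uniform_count_measure A) (uniform_count_measure A)"
    by (auto simp: measurable_def space_uniform_count_measure sets_uniform_count_measure)
  show "distr (uniform_count_measure A) (uniform_count_measure A) p = uniform_count_measure A"
  proof (rule measure_eqI)
    fix B assume "B \<in> sets (distr (uniform_count_measure A) (uniform_count_measure A) p)"
    then have B: "B \<subseteq> A" by (simp add: sets_uniform_count_measure)
    have pA: "p ` A = A" using assms(2) by (simp add: bij_betw_def)
    have "p ` (p -` B \<inter> A) = B"
    proof (intro subset_antisym subsetI)
      fix x assume "x \<in> B"
      then have "x \<in> p ` A" using B pA by auto
      with \<open>x \<in> B\<close> show "x \<in> p ` (p -` B \<inter> A)" by auto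
    qed auto
    then have "bij_betw p (p -` B \<inter> A) B"
      using assms(2) by (auto simp: bij_betw_def intro: inj_on_subset)
    then have "card (p -` B \<inter> A) = card B" by (rule bij_betw_same_card)
    then show "emeasure (distr (uniform_count_measure A) (uniform_count_measure A) p) B =
        emeasure (uniform_count_measure A) B"
      using assms(1) B meas
      by (simp add: emeasure_distr sets_uniform_count_measure space_uniform_count_measure
          emeasure_uniform_count_measure)
  qed (simp)
qed

text \<open>Comparing patterns in both directions makes all patterns on a finite \<open>J\<close>
  equally likely; total mass one then fixes their probability, and every box is a finite disjoint
  union of patterns. An inequality is assumed because a measure-preserving map of one event into
  another yields just that.\<close>

lemma eq_uniform_PiM:
  assumes A: "finite A" "A \<noteq> {}"
    and sets: "sets \<mu> = sets (PiM I (\<lambda>_. uniform_count_measure A))" and prob: "prob_space \<mu>"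
    and pat: "\<And>J \<alpha> \<beta>. finite J \<Longrightarrow> J \<subseteq> I \<Longrightarrow> \<alpha> \<in> J \<rightarrow>\<^sub>E A \<Longrightarrow> \<beta> \<in> J \<rightarrow>\<^sub>E A \<Longrightarrow>
      emeasure \<mu> {e \<in> space \<mu>. \<forall>z\<in>J. e z = \<alpha> z} \<le> emeasure \<mu> {e \<in> space \<mu>. \<forall>z\<in>J. e z = \<beta> z}"
  shows "\<mu> = PiM I (\<lambda>_. uniform_count_measure A)"
proof (rule measure_eqI_PiM_infinite[OF sets refl])
  interpret \<mu>: prob_space \<mu> by (rule prob)
  show "finite_measure \<mu>" by unfold_locales
  let ?M = "\<lambda>_. uniform_count_measure A"
  have sp: "space \<mu> = I \<rightarrow>\<^sub>E A"
    using sets_eq_imp_space_eq[OF sets] by (simp add: space_PiM space_uniform_count_measure)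
  fix B J assume J: "finite J" "J \<subseteq> I" and "\<And>i. i \<in> J \<Longrightarrow> B i \<in> sets (?M i)"
  then have B: "B i \<subseteq> A" if "i \<in> J" for i using that by (simp add: sets_uniform_count_measure)
  define cyl where "cyl \<alpha> = {e \<in> space \<mu>. \<forall>z\<in>J. e z = \<alpha> z}" for \<alpha>
  have emb: "prod_emb I ?M J (Pi\<^sub>E J D) = (\<Union>\<alpha>\<in>Pi\<^sub>E J D. cyl \<alpha>)" for D
  proof (intro set_eqI iffI)
    fix e assume "e \<in> prod_emb I ?M J (Pi\<^sub>E J D)"
    then show "e \<in> (\<Union>\<alpha>\<in>Pi\<^sub>E J D. cyl \<alpha>)"
      by (intro UN_I[of "restrict e J"]) (auto simp: prod_emb_def cyl_def sp space_uniform_count_measure)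
  next
    fix e assume "e \<in> (\<Union>\<alpha>\<in>Pi\<^sub>E J D. cyl \<alpha>)"
    then obtain \<alpha> where \<alpha>: "\<alpha> \<in> Pi\<^sub>E J D" "e \<in> cyl \<alpha>" by blast
    then have "restrict e J = \<alpha>" by (auto simp: cyl_def restrict_def fun_eq_iff PiE_iff extensional_def)
    with \<alpha> show "e \<in> prod_emb I ?M J (Pi\<^sub>E J D)"
      by (auto simp: prod_emb_def cyl_def sp space_uniform_count_measure PiE_iff)
  qed
  have emb_sets: "prod_emb I ?M J (Pi\<^sub>E J D) \<in> sets \<mu>" if "\<And>i. i \<in> J \<Longrightarrow> D i \<subseteq> A" for D
    unfolding sets using J that by (intro sets_PiM_I) (auto simp: sets_uniform_count_measure)
  have cyl_sets: "cyl \<alpha> \<in> sets \<mu>" if "\<alpha> \<in> J \<rightarrow>\<^sub>E A" for \<alpha>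
  proof -
    have "Pi\<^sub>E J (\<lambda>i. {\<alpha> i}) = {\<alpha>}" using that by (intro PiE_singleton) (auto simp: PiE_def)
    then show ?thesis using emb[of "\<lambda>i. {\<alpha> i}"] emb_sets[of "\<lambda>i. {\<alpha> i}"] that by auto
  qed
  obtain \<alpha>0 where \<alpha>0: "\<alpha>0 \<in> J \<rightarrow>\<^sub>E A" using A by (metis PiE_eq_empty_iff ex_in_conv)
  define q where "q = measure \<mu> (cyl \<alpha>0)"
  have q: "measure \<mu> (cyl \<alpha>) = q" if "\<alpha> \<in> J \<rightarrow>\<^sub>E A" for \<alpha>
  proof -
    have "emeasure \<mu> (cyl \<alpha>) = emeasure \<mu> (cyl \<alpha>0)"
      unfolding cyl_def by (rule antisym) (use pat J that \<alpha>0 in auto)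
    then show ?thesis by (simp add: q_def measure_def)
  qed
  have tot: "measure \<mu> (prod_emb I ?M J (Pi\<^sub>E J D)) = (\<Prod>i\<in>J. real (card (D i))) * q"
    if D: "\<And>i. i \<in> J \<Longrightarrow> D i \<subseteq> A" for D
  proof -
    have DA: "Pi\<^sub>E J D \<subseteq> J \<rightarrow>\<^sub>E A" using D by (intro PiE_mono) auto
    have fin: "finite (Pi\<^sub>E J D)" using finite_subset[OF D A(1)] J by (intro finite_PiE)
    have "measure \<mu> (prod_emb I ?M J (Pi\<^sub>E J D)) = (\<Sum>\<alpha>\<in>Pi\<^sub>E J D. measure \<mu> (cyl \<alpha>))"
      unfolding emb
    proof (rule \<mu>.finite_measure_finite_Union[OF fin])
      show "cyl ` Pi\<^sub>E J D \<subseteq> sets \<mu>" using DA cyl_sets by auto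
      show "disjoint_family_on cyl (Pi\<^sub>E J D)"
        unfolding disjoint_family_on_def
      proof (intro ballI impI)
        fix \<alpha> \<beta> assume ab: "\<alpha> \<in> Pi\<^sub>E J D" "\<beta> \<in> Pi\<^sub>E J D" "\<alpha> \<noteq> \<beta>"
        then obtain z where "z \<in> J" "\<alpha> z \<noteq> \<beta> z" by (metis PiE_ext)
        then show "cyl \<alpha> \<inter> cyl \<beta> = {}" by (auto simp: cyl_def)
      qed
    qed
    also have "\<dots> = (\<Sum>\<alpha>\<in>Pi\<^sub>E J D. q)" using DA q by (intro sum.cong) auto
    also have "\<dots> = (\<Prod>i\<in>J. real (card (D i))) * q" using J by (simp add: card_PiE)
    finally show ?thesis .
  qed
  have "prod_emb I ?M J (J \<rightarrow>\<^sub>E A) = space \<mu>"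
    using J(2) by (auto simp: prod_emb_def sp space_uniform_count_measure restrict_PiE_iff PiE_iff subset_eq)
  with tot[of "\<lambda>_. A"] have "1 = real (card A) ^ card J * q" by (simp add: \<mu>.prob_space)
  moreover have "card A \<noteq> 0" using A by simp
  ultimately have qv: "q = 1 / real (card A) ^ card J" by (simp add: field_simps)
  have "emeasure \<mu> (prod_emb I ?M J (Pi\<^sub>E J B)) = ennreal ((\<Prod>i\<in>J. real (card (B i))) * q)"
    using tot[of B] B by (simp add: \<mu>.emeasure_eq_measure)
  also have "(\<Prod>i\<in>J. real (card (B i))) * q = (\<Prod>i\<in>J. real (card (B i)) / real (card A))"
    by (simp add: qv prod_dividef)
  also have "ennreal \<dots> = (\<Prod>i\<in>J. ennreal (real (card (B i)) / real (card A)))"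
    by (rule prod_ennreal[symmetric]) simp
  also have "\<dots> = (\<Prod>i\<in>J. emeasure (uniform_count_measure A) (B i))"
    using A B by (intro prod.cong) (auto simp: emeasure_uniform_count_measure)
  also have "\<dots> = PiM I ?M (prod_emb I ?M J (Pi\<^sub>E J B))"
    using J B A by (intro emeasure_PiM_emb[symmetric] prob_space_uniform_count_measure)
      (auto simp: sets_uniform_count_measure)
  finally show "emeasure \<mu> (prod_emb I ?M J (Pi\<^sub>E J B)) = PiM I ?M (prod_emb I ?M J (Pi\<^sub>E J B))" .
qed

section \<open>The automaton of a tile system\<close>

text \<open>The bit of the edge from \<open>z\<close> in direction \<open>v\<close> is stored at the
  head of the edge, as membership of \<open>v\<close> in the set of directions, so each edge is
  owned by exactly one cell. The last component is the output parity.\<close>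

type_synonym 't cstate = "'t \<times> 't \<times> dir set \<times> bool"

definition cstates :: "'t set \<Rightarrow> 't cstate set" where
  "cstates TS = TS \<times> TS \<times> UNIV \<times> UNIV"

definition tile1 :: "'t cstate \<Rightarrow> 't" where "tile1 s = fst s"
definition tile2 :: "'t cstate \<Rightarrow> 't" where "tile2 s = fst (snd s)"
definition bits :: "'t cstate \<Rightarrow> dir set" where "bits s = fst (snd (snd s))"
definition par :: "'t cstate \<Rightarrow> bool" where "par s = snd (snd (snd s))"

lemma cstate_simps [simp]:
  "tile1 (a, b, h, x) = a" "tile2 (a, b, h, x) = b" "bits (a, b, h, x) = h" "par (a, b, h, x) = x"
  by (simp_all add: tile1_def tile2_def bits_def par_def)

lemma cstate_collapse: "(tile1 s, tile2 s, bits s, par s) = s"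
  by (simp add: tile1_def tile2_def bits_def par_def)

lemma cstates_iff: "s \<in> cstates TS \<longleftrightarrow> tile1 s \<in> TS \<and> tile2 s \<in> TS"
  by (cases s) (simp add: cstates_def)

text \<open>
  The two tiles form a shift register: after two steps both are fresh, while the second tile of
  the initial state controls the second step. Noise symbols are states whose first tile is ignored.
\<close>

definition tile_step ::
  "('t \<Rightarrow> 't \<Rightarrow> 't \<Rightarrow> bool) \<Rightarrow> ('t \<Rightarrow> dir set) \<Rightarrow> ('t \<Rightarrow> dir set)
    \<Rightarrow> 't cstate \<Rightarrow> (dir \<Rightarrow> 't cstate) \<Rightarrow> 't cstate \<Rightarrow> 't cstate" where
  "tile_step vld nout nin s nb w =
     (tile2 s, tile2 w, bits w,
      if vld (tile1 s) (tile1 (nb East)) (tile1 (nb North))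
      then odd (card {v \<in> nout (tile1 s). v \<in> bits (nb v)} + card (nin (tile1 s) \<inter> bits s))
      else par w)"

definition enc :: "'t set \<Rightarrow> 't cstate \<Rightarrow> nat" where
  "enc TS = to_nat_on (cstates TS)"

definition dec :: "'t set \<Rightarrow> nat \<Rightarrow> 't cstate" where
  "dec TS = from_nat_into (cstates TS)"

text \<open>The digits of the index in base \<open>k\<close>, least significant first, are the cell
  itself, its \<open>East\<close>, \<open>North\<close> and \<open>Long\<close> neighbours and the
  random symbol, in the order in which \<open>local_fun\<close> arranges them for
  \<open>tile_ca\<close>.\<close>

definition tile_table ::
  "'t set \<Rightarrow> ('t \<Rightarrow> 't \<Rightarrow> 't \<Rightarrow> bool) \<Rightarrow> ('t \<Rightarrow> dir set) \<Rightarrow> ('t \<Rightarrow> dir set) \<Rightarrow> nat list" where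
  "tile_table TS vld nout nin = (let k = card (cstates TS) in
     map (\<lambda>i. enc TS (tile_step vld nout nin (dec TS (i mod k))
        (\<lambda>v. case v of
            East \<Rightarrow> dec TS (i div k mod k)
          | North \<Rightarrow> dec TS (i div k div k mod k)
          | Long \<Rightarrow> dec TS (i div k div k div k mod k))
        (dec TS (i div k div k div k div k)))) [0..<k ^ 4 * k])"

definition tile_ca ::
  "nat \<Rightarrow> nat \<Rightarrow> 't set \<Rightarrow> ('t \<Rightarrow> 't \<Rightarrow> 't \<Rightarrow> bool) \<Rightarrow> ('t \<Rightarrow> dir set) \<Rightarrow> ('t \<Rightarrow> dir set) \<Rightarrow> sca" where
  "tile_ca d m TS vld nout nin =
     \<lparr>states = card (cstates TS), symbols = card (cstates TS),
      nbhd = [replicate d 0, vec d m East, vec d m North, vec d m Long],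
      rnbhd = [replicate d 0], rule_table = tile_table TS vld nout nin\<rparr>"

instance dir :: finite
proof
  have "(UNIV :: dir set) = {East, North, Long}" by (auto intro: dir.exhaust)
  then show "finite (UNIV :: dir set)" by (metis finite.emptyI finite.insertI)
qed

lemma digit_bound: "a < k \<Longrightarrow> b < n \<Longrightarrow> a + k * b < k * (n::nat)"
proof -
  assume "a < k" "b < n"
  then have "a + k * b < k * Suc b" by simp
  also have "\<dots> \<le> k * n" using \<open>b < n\<close> by (intro mult_le_mono2) simp
  finally show ?thesis .
qed

text \<open>The bound on \<open>m\<close> separates \<open>Long\<close> from the zero vector and
  from \<open>East\<close>, so that the neighbourhood consists of four different vectors.\<close>

locale tile_automaton =
  fixes d m :: nat and TS :: "'t set"
    and vld :: "'t \<Rightarrow> 't \<Rightarrow> 't \<Rightarrow> bool" and nout nin :: "'t \<Rightarrow> dir set"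
  assumes d: "2 \<le> d" and m: "2 \<le> m" and finite_TS: "finite TS" and TS_nonempty: "TS \<noteq> {}"
begin

abbreviation "k \<equiv> card (cstates TS)"
abbreviation "A \<equiv> tile_ca d m TS vld nout nin"
abbreviation "sh \<equiv> shift d m"

lemma A_simps [simp]:
  "states A = k" "symbols A = k" "rule_table A = tile_table TS vld nout nin"
  "nbhd A = [replicate d 0, vec d m East, vec d m North, vec d m Long]" "rnbhd A = [replicate d 0]"
  by (simp_all add: tile_ca_def)

lemma finite_cstates: "finite (cstates TS)"
  unfolding cstates_def using finite_TS by (intro finite_cartesian_product) auto

lemma k_pos: "0 < k"
  using finite_cstates TS_nonempty by (auto simp: card_gt_0_iff cstates_def)

lemma enc_less: "s \<in> cstates TS \<Longrightarrow> enc TS s < k"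
  using to_nat_on_finite[OF finite_cstates] by (auto simp: enc_def bij_betw_def)

lemma dec_enc [simp]: "s \<in> cstates TS \<Longrightarrow> dec TS (enc TS s) = s"
  by (simp add: enc_def dec_def finite_cstates countable_finite)

lemma dec_mem: "dec TS i \<in> cstates TS"
  using k_pos unfolding dec_def by (intro from_nat_into) auto

lemma enc_dec: "i < k \<Longrightarrow> enc TS (dec TS i) = i"
  using to_nat_on_finite[OF finite_cstates] unfolding enc_def dec_def
  by (intro to_nat_on_from_nat_into) (simp add: bij_betw_def)

lemma tile_step_mem: "s \<in> cstates TS \<Longrightarrow> w \<in> cstates TS \<Longrightarrow> tile_step vld nout nin s nb w \<in> cstates TS"
  by (simp add: cstates_iff tile_step_def)

lemma local_fun_A:
  assumes "u0 < k" "u1 < k" "u2 < k" "u3 < k" "w < k"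
  shows "local_fun A [u0, u1, u2, u3] [w] =
    enc TS (tile_step vld nout nin (dec TS u0)
      (\<lambda>v. case v of East \<Rightarrow> dec TS u1 | North \<Rightarrow> dec TS u2 | Long \<Rightarrow> dec TS u3) (dec TS w))"
proof -
  define i where "i = u0 + k * (u1 + k * (u2 + k * (u3 + k * w)))"
  have dm: "(a + k * b) mod k = a" "(a + k * b) div k = b" if "a < k" for a b
    using that k_pos by auto
  have "i < k * (k * (k * (k * k)))"
    unfolding i_def using assms by (intro digit_bound)
  then have lt: "i < k ^ 4 * k" by (simp add: power_numeral_reduce mult.assoc)
  have idx: "horner_sum id k [u0, u1, u2, u3] + k ^ length [u0, u1, u2, u3] * horner_sum id k [w] = i"
    by (simp add: i_def algebra_simps power_numeral_reduce)
  show ?thesis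
    unfolding local_fun_def A_simps idx tile_table_def Let_def
    using lt assms by (simp add: i_def dm)
qed

lemma is_cfca_A: "is_cfca d A"
proof -
  have len: "length (tile_table TS vld nout nin) = k ^ 4 * k"
    by (simp add: tile_table_def Let_def)
  have "set (tile_table TS vld nout nin) \<subseteq> {..<k}"
    by (auto simp: tile_table_def Let_def intro!: enc_less tile_step_mem dec_mem)
  moreover have "replicate d 0 = 0 # 0 # replicate (d - 2) (0::int)"
  proof -
    obtain e where "d = Suc (Suc e)" using d by (metis add_2_eq_Suc le_Suc_ex)
    then show ?thesis by simp
  qed
  ultimately show ?thesis
    using k_pos d m len
    by (auto simp: is_cfca_def is_sca_def cells_def power_numeral_reduce)
qed

text \<open>No edge is a loop. Hence the bits on the outgoing and on the incoming edges of a cell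
  are different unknowns.\<close>

lemma cells_sh:
  assumes "z \<in> cells d"
  shows "sh v z \<in> cells d" "sh v z \<noteq> z"
proof -
  obtain x y r where z: "z = x # y # r" "length r = d - 2" using assms cells_eq[OF d] by blast
  then show "sh v z \<in> cells d" "sh v z \<noteq> z"
    using d m by (cases v; auto simp: shift_Cons cells_def)+
qed

lemma sh_inject: "z \<in> cells d \<Longrightarrow> z' \<in> cells d \<Longrightarrow> sh v z = sh v z' \<longleftrightarrow> z = z'"
  using cells_eq[OF d, of z] cells_eq[OF d, of z'] by (cases v) (auto simp: shift_Cons)

lemma sh_surj:
  assumes "w \<in> cells d"
  shows "\<exists>z\<in>cells d. sh v z = w"
proof -
  obtain x y r where w: "w = x # y # r" "length r = d - 2" using assms cells_eq[OF d] by blast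
  then have "x' # y' # r \<in> cells d" for x' y' using d by (simp add: cells_def)
  moreover have "sh East ((x - 1) # y # r) = w" "sh North (x # (y - 1) # r) = w"
      "sh Long ((x - int m) # y # r) = w"
    using w by (simp_all add: shift_Cons)
  ultimately show ?thesis by (cases v) blast+
qed

lemma configsD: "c \<in> configs d k \<Longrightarrow> z \<in> cells d \<Longrightarrow> c z < k"
  by (auto simp: configs_def)

lemma global_fun_A:
  assumes c: "c \<in> configs d k" and s: "s \<in> configs d k" and z: "z \<in> cells d"
  shows "global_fun d A c s z =
    enc TS (tile_step vld nout nin (dec TS (c z)) (\<lambda>v. dec TS (c (sh v z))) (dec TS (s z)))"
proof -
  have z0: "map2 (+) z (replicate d 0) = z"
    using z map2_add_zeros[of z d] by (simp add: cells_def)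
  have nb: "(\<lambda>v. case v of East \<Rightarrow> dec TS (c (sh East z)) | North \<Rightarrow> dec TS (c (sh North z))
        | Long \<Rightarrow> dec TS (c (sh Long z))) = (\<lambda>v. dec TS (c (sh v z)))"
    by (rule ext) (simp split: dir.split)
  have "global_fun d A c s z = local_fun A [c z, c (sh East z), c (sh North z), c (sh Long z)] [s z]"
    using z by (simp add: global_fun_def z0 shift_def del: vec.simps)
  also have "\<dots> = enc TS (tile_step vld nout nin (dec TS (c z)) (\<lambda>v. dec TS (c (sh v z))) (dec TS (s z)))"
    using configsD[OF c] configsD[OF s] z cells_sh(1)[OF z] by (simp add: local_fun_A nb)
  finally show ?thesis .
qed

lemma global_fun_configs:
  assumes "c \<in> configs d k" "s \<in> configs d k"
  shows "global_fun d A c s \<in> configs d k"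
  using global_fun_A[OF assms] enc_less[OF tile_step_mem[OF dec_mem dec_mem]]
  by (auto simp: configs_def global_fun_def extensional_def)

lemma dec_global_fun:
  assumes "c \<in> configs d k" "s \<in> configs d k" "z \<in> cells d"
  shows "dec TS (global_fun d A c s z) =
    tile_step vld nout nin (dec TS (c z)) (\<lambda>v. dec TS (c (sh v z))) (dec TS (s z))"
  using global_fun_A[OF assms] by (simp add: tile_step_mem dec_mem)

section \<open>The second step as a system of parity equations\<close>

text \<open>
  The second step is a linear system over the field with two elements: the equation of a valid
  cell adds up the edge bits at its edges, and \<open>(z, None)\<close> is the noise bit of an invalid cell.
\<close>

definition eqn :: "(int list \<Rightarrow> 't) \<Rightarrow> int list \<Rightarrow> (int list \<times> dir option) set" where
  "eqn b z = (if vld (b z) (b (sh East z)) (b (sh North z))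
     then (\<lambda>v. (sh v z, Some v)) ` nout (b z) \<union> (\<lambda>v. (z, Some v)) ` nin (b z)
     else {(z, None)})"

text \<open>An assignment, given as the set of unknowns with value one. It merges two layers of
  noise: edge bits are drawn in the first step, the bit of an invalid cell in the second.\<close>

definition unknowns :: "(int list \<Rightarrow> nat) \<Rightarrow> (int list \<Rightarrow> nat) \<Rightarrow> (int list \<times> dir option) set" where
  "unknowns s1 s2 = {(z, w). case w of Some v \<Rightarrow> v \<in> bits (dec TS (s1 z)) | None \<Rightarrow> par (dec TS (s2 z))}"

definition control :: "(int list \<Rightarrow> nat) \<Rightarrow> int list \<Rightarrow> 't" where
  "control c z = tile2 (dec TS (c z))"

lemma finite_eqn: "finite (eqn b z)"
  by (auto simp: eqn_def)

lemma card_eqn: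
  assumes "z \<in> cells d" "vld (b z) (b (sh East z)) (b (sh North z))"
  shows "card (eqn b z \<inter> H) =
    card {v \<in> nout (b z). (sh v z, Some v) \<in> H} + card {v \<in> nin (b z). (z, Some v) \<in> H}"
proof -
  have "eqn b z \<inter> H = (\<lambda>v. (sh v z, Some v)) ` {v \<in> nout (b z). (sh v z, Some v) \<in> H}
      \<union> (\<lambda>v. (z, Some v)) ` {v \<in> nin (b z). (z, Some v) \<in> H}"
    using assms(2) by (auto simp: eqn_def)
  also have "card \<dots> = card ((\<lambda>v. (sh v z, Some v)) ` {v \<in> nout (b z). (sh v z, Some v) \<in> H})
      + card ((\<lambda>v. (z, Some v)) ` {v \<in> nin (b z). (z, Some v) \<in> H})"
    using cells_sh(2)[OF assms(1)] by (intro card_Un_disjoint) auto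
  also have "\<dots> = card {v \<in> nout (b z). (sh v z, Some v) \<in> H} + card {v \<in> nin (b z). (z, Some v) \<in> H}"
    by (intro arg_cong2[where f="(+)"] card_image inj_onI) auto
  finally show ?thesis .
qed

lemma iterate_2: "iterate d A 2 c s = global_fun d A (global_fun d A c (s 1)) (s 2)"
  by (simp add: numeral_2_eq_2)

lemma iterate_configs:
  assumes "c \<in> configs d k" "s 1 \<in> configs d k" "s 2 \<in> configs d k"
  shows "iterate d A 2 c s \<in> configs d k"
  using assms by (simp add: iterate_2 global_fun_configs)

text \<open>The four components use disjoint parts of the noise: the tiles come from the second
  tiles of both symbols, the stored bits from the second symbol, and the parity from the bits of the
  first symbol and \<open>par\<close> of the second. Dependence between cells can thus arise only
  through the parities.\<close>

lemma dec_iterate: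
  assumes c: "c \<in> configs d k" and s: "s 1 \<in> configs d k" "s 2 \<in> configs d k" and z: "z \<in> cells d"
  shows "dec TS (iterate d A 2 c s z) =
    (tile2 (dec TS (s 1 z)), tile2 (dec TS (s 2 z)), bits (dec TS (s 2 z)),
     odd (card (eqn (control c) z \<inter> unknowns (s 1) (s 2))))"
proof -
  let ?c1 = "global_fun d A c (s 1)"
  have c1: "?c1 \<in> configs d k" using global_fun_configs[OF c s(1)] .
  have t: "tile1 (dec TS (?c1 w)) = control c w" "tile2 (dec TS (?c1 w)) = tile2 (dec TS (s 1 w))"
     "bits (dec TS (?c1 w)) = bits (dec TS (s 1 w))" if "w \<in> cells d" for w
    using dec_global_fun[OF c s(1) that] by (simp_all add: tile_step_def control_def)
  show ?thesis
  proof (cases "vld (control c z) (control c (sh East z)) (control c (sh North z))")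
    case True
    have "nin (control c z) \<inter> bits (dec TS (s 1 z)) = {v \<in> nin (control c z). v \<in> bits (dec TS (s 1 z))}"
      by blast
    then show ?thesis
      using dec_global_fun[OF c1 s(2) z] t z cells_sh(1)[OF z] True card_eqn[OF z, of "control c"]
      by (simp add: iterate_2 tile_step_def unknowns_def)
  next
    case False
    then have "eqn (control c) z = {(z, None)}" by (simp add: eqn_def)
    then have "odd (card (eqn (control c) z \<inter> unknowns (s 1) (s 2))) = par (dec TS (s 2 z))"
      by (simp add: unknowns_def Int_insert_left)
    then show ?thesis
      using dec_global_fun[OF c1 s(2) z] t z cells_sh(1)[OF z] False
      by (simp add: iterate_2 tile_step_def)
  qed
qed

abbreviation "patch \<equiv> closed_patch d m vld nout nin"

text \<open>By closedness \<open>(z, v) \<mapsto> (sh v z, v)\<close> is a bijection from the edges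
  leaving cells of \<open>Z\<close> to the edges entering cells of \<open>Z\<close>, and it respects
  the bits in \<open>H\<close>; so both halves of the sum agree.\<close>

lemma patch_even:
  assumes p: "patch b Z"
  shows "even (\<Sum>z\<in>Z. card (eqn b z \<inter> H))"
proof -
  have Zc: "Z \<subseteq> cells d" and fin: "finite Z"
    and ok: "\<And>z. z \<in> Z \<Longrightarrow> vld (b z) (b (sh East z)) (b (sh North z))"
    and cl: "\<And>z v. z \<in> cells d \<Longrightarrow> (z \<in> Z \<and> v \<in> nout (b z)) \<longleftrightarrow> (sh v z \<in> Z \<and> v \<in> nin (b (sh v z)))"
    using p unfolding closed_patch_def by blast+
  define S1 where "S1 z = {v \<in> nout (b z). (sh v z, Some v) \<in> H}" for z
  define S2 where "S2 z = {v \<in> nin (b z). (z, Some v) \<in> H}" for z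
  have "bij_betw (\<lambda>(z, v). (sh v z, v)) (Sigma Z S1) (Sigma Z S2)"
  proof (rule bij_betwI')
    fix x y assume "x \<in> Sigma Z S1" "y \<in> Sigma Z S1"
    then show "(case x of (z, v) \<Rightarrow> (sh v z, v)) = (case y of (z, v) \<Rightarrow> (sh v z, v)) \<longleftrightarrow> x = y"
      using sh_inject Zc by (auto split: prod.splits)
  next
    fix x assume "x \<in> Sigma Z S1"
    then obtain z v where x: "x = (z, v)" "z \<in> Z" "v \<in> nout (b z)" "(sh v z, Some v) \<in> H"
      by (auto simp: S1_def)
    with cl[of z v] Zc show "(case x of (z, v) \<Rightarrow> (sh v z, v)) \<in> Sigma Z S2"
      by (auto simp: S2_def)
  next
    fix y assume "y \<in> Sigma Z S2"
    then obtain w v where y: "y = (w, v)" "w \<in> Z" "v \<in> nin (b w)" "(w, Some v) \<in> H"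
      by (auto simp: S2_def)
    obtain z where z: "z \<in> cells d" "sh v z = w" using sh_surj[of w v] y Zc by blast
    with cl[OF z(1), of v] y have "z \<in> Z" "v \<in> nout (b z)" by auto
    with y z show "\<exists>x\<in>Sigma Z S1. y = (case x of (z, v) \<Rightarrow> (sh v z, v))"
      by (intro bexI[of _ "(z, v)"]) (auto simp: S1_def)
  qed
  then have "card (Sigma Z S1) = card (Sigma Z S2)" by (rule bij_betw_same_card)
  then have eq: "(\<Sum>z\<in>Z. card (S1 z)) = (\<Sum>z\<in>Z. card (S2 z))" using fin by simp
  have "(\<Sum>z\<in>Z. card (eqn b z \<inter> H)) = (\<Sum>z\<in>Z. card (S1 z) + card (S2 z))"
    using card_eqn ok Zc by (intro sum.cong) (auto simp: S1_def S2_def)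
  then show ?thesis by (simp add: sum.distrib eq)
qed

text \<open>If every unknown of \<open>Z\<close> occurred in a second equation of \<open>Z\<close>,
  no cell of \<open>Z\<close> could be invalid, because the noise bit of an invalid cell occurs
  nowhere else, and every edge used at one end would be used at its other end within
  \<open>Z\<close> as well. Then \<open>Z\<close> would be closed.\<close>

lemma private_unknown:
  assumes np: "\<not> patch b Z" and Z: "finite Z" "Z \<subseteq> cells d" "Z \<noteq> {}"
  shows "\<exists>z\<in>Z. \<exists>y\<in>eqn b z. \<forall>z'\<in>Z - {z}. y \<notin> eqn b z'"
proof (rule ccontr)
  assume *: "\<not> ?thesis"
  have shared: "\<exists>z'\<in>Z. z' \<noteq> z \<and> y \<in> eqn b z'" if "z \<in> Z" "y \<in> eqn b z" for z y
    using * that by blast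
  have ok: "vld (b z) (b (sh East z)) (b (sh North z))" if "z \<in> Z" for z
  proof (rule ccontr)
    assume "\<not> vld (b z) (b (sh East z)) (b (sh North z))"
    then have "(z, None) \<in> eqn b z" by (simp add: eqn_def)
    then show False using shared[OF that] by (auto simp: eqn_def split: if_splits)
  qed
  have mem: "(w, Some v) \<in> eqn b z \<longleftrightarrow> (w = sh v z \<and> v \<in> nout (b z)) \<or> (w = z \<and> v \<in> nin (b z))" if "z \<in> Z" for z w v
    using ok[OF that] by (auto simp: eqn_def)
  have "(z \<in> Z \<and> v \<in> nout (b z)) \<longleftrightarrow> (sh v z \<in> Z \<and> v \<in> nin (b (sh v z)))" if z: "z \<in> cells d" for z v
  proof
    assume zv: "z \<in> Z \<and> v \<in> nout (b z)"
    then have "(sh v z, Some v) \<in> eqn b z" using mem by blast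
    then obtain z' where z': "z' \<in> Z" "z' \<noteq> z" "(sh v z, Some v) \<in> eqn b z'" using shared zv by blast
    then show "sh v z \<in> Z \<and> v \<in> nin (b (sh v z))"
      using mem[OF z'(1)] sh_inject[OF z, of z'] Z(2) by auto
  next
    assume zv: "sh v z \<in> Z \<and> v \<in> nin (b (sh v z))"
    then have "(sh v z, Some v) \<in> eqn b (sh v z)" using mem by blast
    then obtain z' where z': "z' \<in> Z" "z' \<noteq> sh v z" "(sh v z, Some v) \<in> eqn b z'" using shared zv by blast
    then show "z \<in> Z \<and> v \<in> nout (b z)"
      using mem[OF z'(1)] sh_inject[OF z, of z'] Z(2) by auto
  qed
  then have "patch b Z" unfolding closed_patch_def using Z ok by blast
  with np show False by blast
qed

lemma solvable_finite:
  assumes "\<And>Z. \<not> patch b Z" "finite J" "J \<subseteq> cells d"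
  shows "\<exists>B. \<forall>z\<in>J. odd (card (eqn b z \<inter> B)) \<longleftrightarrow> \<delta> z"
proof (rule parity_system_finite[OF assms(2) finite_eqn])
  fix Z assume "Z \<subseteq> J" "Z \<noteq> {}"
  with assms show "\<exists>z\<in>Z. \<exists>y\<in>eqn b z. \<forall>z'\<in>Z - {z}. y \<notin> eqn b z'"
    by (intro private_unknown) (auto intro: finite_subset)
qed

text \<open>Noisiness asks for a solution on all cells at once, hence the compactness argument; for
  the law, patterns on finitely many cells suffice.\<close>

lemma solvable:
  assumes "\<And>Z. \<not> patch b Z"
  shows "\<exists>B. \<forall>z\<in>cells d. odd (card (eqn b z \<inter> B)) \<longleftrightarrow> \<delta> z"
  by (rule parity_system_compact[OF finite_eqn solvable_finite[OF assms]])

definition has_patch :: bool where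
  "has_patch \<longleftrightarrow> (\<exists>a Z. (\<forall>z\<in>cells d. a z \<in> TS) \<and> patch a Z)"

lemma control_mem: "control c z \<in> TS"
  using dec_mem by (simp add: control_def cstates_iff)

lemma no_patch_control: "\<not> has_patch \<Longrightarrow> \<not> patch (control c) Z"
  using control_mem unfolding has_patch_def by blast

text \<open>On a closed patch the equations add up to zero, so no pattern of odd parity is reached.\<close>

lemma unreachable_pattern:
  assumes has_patch
  shows "\<exists>c\<in>configs d k. \<exists>\<alpha>\<in>configs d k. \<exists>Z\<subseteq>cells d. finite Z \<and>
    (\<forall>s. s 1 \<in> configs d k \<longrightarrow> s 2 \<in> configs d k \<longrightarrow> (\<exists>z\<in>Z. iterate d A 2 c s z \<noteq> \<alpha> z))"
proof -
  obtain a Z where a: "\<forall>z\<in>cells d. a z \<in> TS" and p: "patch a Z" using assms unfolding has_patch_def by blast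
  then have Z: "Z \<subseteq> cells d" "finite Z" "Z \<noteq> {}" unfolding closed_patch_def by blast+
  obtain z0 where z0: "z0 \<in> Z" using Z by blast
  obtain t0 where t0: "t0 \<in> TS" using TS_nonempty by blast
  define c where "c = (\<lambda>z\<in>cells d. enc TS (t0, a z, {}, False))"
  \<comment> \<open>The target parity is one at the single cell \<open>z0\<close>, so the outputs on
    \<open>Z\<close> would sum to one, against the even sum forced by closedness.\<close>
  define \<alpha> where "\<alpha> = (\<lambda>z\<in>cells d. enc TS (t0, t0, {}, z = z0))"
  have c: "c \<in> configs d k" using a t0 by (auto simp: c_def configs_def cstates_iff intro!: enc_less)
  have \<alpha>: "\<alpha> \<in> configs d k" using t0 by (auto simp: \<alpha>_def configs_def cstates_iff intro!: enc_less)
  have ca: "control c z = a z" if "z \<in> cells d" for z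
    using that a t0 by (simp add: control_def c_def cstates_iff)
  have ec: "eqn (control c) z = eqn a z" if "z \<in> cells d" for z
    using ca[OF that] ca[OF cells_sh(1)[OF that]] by (simp add: eqn_def)
  have "\<exists>z\<in>Z. iterate d A 2 c s z \<noteq> \<alpha> z" if s: "s 1 \<in> configs d k" "s 2 \<in> configs d k" for s
  proof (rule ccontr)
    assume *: "\<not> ?thesis"
    have "odd (card (eqn a z \<inter> unknowns (s 1) (s 2))) \<longleftrightarrow> z = z0" if z: "z \<in> Z" for z
    proof -
      have zc: "z \<in> cells d" using z Z by blast
      have "dec TS (iterate d A 2 c s z) = dec TS (\<alpha> z)" using * z by auto
      also have "\<dots> = (t0, t0, {}, z = z0)" using zc t0 by (simp add: \<alpha>_def cstates_iff)
      finally show ?thesis using dec_iterate[of c s, OF c s zc] ec[OF zc] by simp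
    qed
    then have "{z \<in> Z. odd (card (eqn a z \<inter> unknowns (s 1) (s 2)))} = {z0}" using z0 by blast
    then have "odd (\<Sum>z\<in>Z. card (eqn a z \<inter> unknowns (s 1) (s 2)))"
      using even_sum_iff[OF Z(2), of "\<lambda>z. card (eqn a z \<inter> unknowns (s 1) (s 2))"] by simp
    with patch_even[OF p] show False by blast
  qed
  with c Z(1,2) \<alpha> show ?thesis by blast
qed

lemma noisy_iff: "noisy_iterate d A 2 \<longleftrightarrow> \<not> has_patch"
proof
  assume noisy: "noisy_iterate d A 2"
  show "\<not> has_patch"
  proof
    assume has_patch
    then obtain c Z \<alpha> where *: "c \<in> configs d k" "finite Z" "Z \<subseteq> cells d" "\<alpha> \<in> configs d k"
      "\<forall>s. s 1 \<in> configs d k \<longrightarrow> s 2 \<in> configs d k \<longrightarrow> (\<exists>z\<in>Z. iterate d A 2 c s z \<noteq> \<alpha> z)"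
      using unreachable_pattern by blast
    have "\<alpha> \<in> {iterate d A 2 c s | s. \<forall>i\<in>{1..2}. s i \<in> configs d k}"
      using noisy * by (auto simp: noisy_iterate_def)
    then obtain s where s: "\<alpha> = iterate d A 2 c s" "\<forall>i\<in>{1..2}. s i \<in> configs d k" by blast
    then have "s 1 \<in> configs d k" "s 2 \<in> configs d k" by auto
    with *(5) s(1) show False by blast
  qed
next
  assume np: "\<not> has_patch"
  have "\<exists>s. e = iterate d A 2 c s \<and> (\<forall>i\<in>{1..2}. s i \<in> configs d k)"
    if c: "c \<in> configs d k" and e: "e \<in> configs d k" for c e
  proof -
    obtain B where B: "\<forall>z\<in>cells d. odd (card (eqn (control c) z \<inter> B)) \<longleftrightarrow> par (dec TS (e z))"
      using solvable[OF no_patch_control[OF np], of c "\<lambda>z. par (dec TS (e z))"] by blast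
    \<comment> \<open>The first symbol supplies the final first tile and the edge bits, the second
      one the remaining tile, the stored bits and the bit of an invalid cell. First tiles of symbols
      are never read, so any tile will do there.\<close>
    define s where "s i = (\<lambda>z\<in>cells d. if i = 1
        then enc TS (tile1 (dec TS (e z)), tile1 (dec TS (e z)), {v. (z, Some v) \<in> B}, False)
        else enc TS (tile1 (dec TS (e z)), tile2 (dec TS (e z)), bits (dec TS (e z)), (z, None) \<in> B))" for i :: nat
    have e': "tile1 (dec TS (e z)) \<in> TS" "tile2 (dec TS (e z)) \<in> TS" for z
      using dec_mem by (simp_all add: cstates_iff)
    have s: "s i \<in> configs d k" for i
      using e' by (auto simp: s_def configs_def cstates_iff intro!: enc_less)
    have ds: "dec TS (s 1 z) = (tile1 (dec TS (e z)), tile1 (dec TS (e z)), {v. (z, Some v) \<in> B}, False)"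
      "dec TS (s 2 z) = (tile1 (dec TS (e z)), tile2 (dec TS (e z)), bits (dec TS (e z)), (z, None) \<in> B)"
      if "z \<in> cells d" for z
      using that e' by (simp_all add: s_def cstates_iff)
    have "iterate d A 2 c s z = e z" if z: "z \<in> cells d" for z
    proof -
      have "eqn (control c) z \<subseteq> cells d \<times> UNIV" using z cells_sh(1) by (auto simp: eqn_def)
      moreover have "y \<in> unknowns (s 1) (s 2) \<longleftrightarrow> y \<in> B" if "fst y \<in> cells d" for y
        using ds[OF that] by (cases y; cases "snd y") (simp_all add: unknowns_def)
      ultimately have "eqn (control c) z \<inter> unknowns (s 1) (s 2) = eqn (control c) z \<inter> B"
        by fastforce
      then have "dec TS (iterate d A 2 c s z) = dec TS (e z)"
        using dec_iterate[of c s, OF c s s z] B z ds[OF z] by (simp add: cstate_collapse)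
      moreover have "iterate d A 2 c s z < k" "e z < k"
        using configsD[OF iterate_configs[of c s, OF c s s] z] configsD[OF e z] by auto
      ultimately show ?thesis by (metis enc_dec)
    qed
    moreover have "iterate d A 2 c s \<in> cells d \<rightarrow>\<^sub>E {..<k}" "e \<in> cells d \<rightarrow>\<^sub>E {..<k}"
      using iterate_configs[of c s, OF c s s] e by (simp_all add: configs_def)
    ultimately have "e = iterate d A 2 c s" by (metis PiE_ext)
    then show ?thesis using s by blast
  qed
  moreover have "iterate d A 2 c s \<in> configs d k"
    if "c \<in> configs d k" "\<forall>i\<in>{1..2}. s i \<in> configs d k" for c s
    using that by (intro iterate_configs) auto
  ultimately show "noisy_iterate d A 2"
    unfolding noisy_iterate_def A_simps by blast
qed

section \<open>The law of the second iterate\<close>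

abbreviation "\<Omega> \<equiv> PiM {1..2::nat} (\<lambda>_. uniform_config d k)"

lemma uniform_sets [simp]: "sets (uniform_count_measure {..<k}) = Pow {..<k}"
  by (rule sets_uniform_count_measure)

lemma prob_uniform: "prob_space (uniform_count_measure {..<k})"
  using k_pos by (intro prob_space_uniform_count_measure) auto

lemma prob_config: "prob_space (uniform_config d k)"
  unfolding uniform_config_def by (intro prob_space_PiM prob_uniform)

lemma prob_Omega: "prob_space \<Omega>"
  by (intro prob_space_PiM prob_config)

lemma space_config: "space (uniform_config d k) = configs d k"
  by (simp add: uniform_config_def space_PiM space_uniform_count_measure configs_def)

lemma space_OmegaD: "s \<in> space \<Omega> \<Longrightarrow> s 1 \<in> configs d k \<and> s 2 \<in> configs d k"
  by (auto simp: space_PiM space_config PiE_iff)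

lemma measurable_coord:
  assumes "f \<in> measurable M (uniform_config d k)" "z \<in> cells d"
  shows "(\<lambda>x. f x z) \<in> measurable M (count_space UNIV)"
proof -
  have "(\<lambda>x. f x z) \<in> measurable M (uniform_count_measure {..<k})"
    using assms unfolding uniform_config_def
    by (rule measurable_compose[OF _ measurable_component_singleton])
  moreover have "(\<lambda>i. i) \<in> measurable (uniform_count_measure {..<k}) (count_space UNIV)"
    by (auto simp: measurable_def space_uniform_count_measure)
  ultimately show ?thesis by (rule measurable_compose)
qed

lemma measurable_uniformI:
  assumes h: "h \<in> measurable M (count_space UNIV)" and "\<And>x. x \<in> space M \<Longrightarrow> h x < k"
  shows "h \<in> measurable M (uniform_count_measure {..<k})"
proof (rule measurableI)
  fix B assume "B \<in> sets (uniform_count_measure {..<k})"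
  show "h -` B \<inter> space M \<in> sets M" using measurable_sets[OF h, of B] by simp
qed (use assms in \<open>simp add: space_uniform_count_measure\<close>)

lemma measurable_map_list:
  assumes "\<And>i. i \<in> set is \<Longrightarrow> (\<lambda>x. f x i) \<in> measurable M (count_space UNIV)"
  shows "(\<lambda>x. map (f x) is) \<in> measurable M (count_space (UNIV :: nat list set))"
  using assms
proof (induction "is")
  case (Cons i "is")
  have "(\<lambda>x. f x i # l) \<in> measurable M (count_space UNIV)" for l
    using Cons.prems[of i] by (rule measurable_compose) auto
  with Cons show ?case
    by (auto intro!: measurable_compose_countable[where f="\<lambda>l x. f x i # l"])
qed simp

text \<open>A cell of the image depends on finitely many coordinates through lists of numbers, which
  form a countable type, so measurability holds whatever the local function is.\<close>

lemma measurable_global_fun: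
  assumes f: "f \<in> measurable M (uniform_config d k)" and g: "g \<in> measurable M (uniform_config d k)"
  shows "(\<lambda>x. global_fun d A (f x) (g x)) \<in> measurable M (uniform_config d k)"
proof -
  have fg: "f x \<in> configs d k" "g x \<in> configs d k" if "x \<in> space M" for x
    using measurable_space[OF f that] measurable_space[OF g that] by (auto simp: space_config)
  have "(\<lambda>x. global_fun d A (f x) (g x) z) \<in> measurable M (uniform_count_measure {..<k})"
    if z: "z \<in> cells d" for z
  proof -
    let ?F = "\<lambda>x. local_fun A (map (f x) (map (map2 (+) z) (nbhd A))) (map (g x) (map (map2 (+) z) (rnbhd A)))"
    have cell: "map2 (+) z v \<in> cells d" if "v \<in> set (nbhd A) \<union> set (rnbhd A)" for v
      using that z d by (auto simp: cells_def)
    have "(\<lambda>x. local_fun A l (map (g x) (map (map2 (+) z) (rnbhd A)))) \<in> measurable M (count_space UNIV)" for l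
      by (rule measurable_compose[OF measurable_map_list[where f=g and M=M]])
        (use cell in \<open>auto intro!: measurable_coord[OF g]\<close>)
    moreover have "(\<lambda>x. map (f x) (map (map2 (+) z) (nbhd A))) \<in> measurable M (count_space UNIV)"
      by (rule measurable_map_list) (use cell in \<open>auto intro!: measurable_coord[OF f] simp del: A_simps\<close>)
    ultimately have F: "?F \<in> measurable M (count_space UNIV)"
      by (rule measurable_compose_countable[where
            f="\<lambda>l x. local_fun A l (map (g x) (map (map2 (+) z) (rnbhd A)))"])
    have eq: "global_fun d A (f x) (g x) z = ?F x" for x
      using z by (simp add: global_fun_def comp_def del: A_simps)
    have "?F x < k" if "x \<in> space M" for x
      using configsD[OF global_fun_configs[OF fg[OF that]] z] by (simp add: eq del: A_simps)
    then show ?thesis unfolding eq by (rule measurable_uniformI[OF F])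
  qed
  then have "(\<lambda>x. \<lambda>z\<in>cells d. global_fun d A (f x) (g x) z) \<in> measurable M (uniform_config d k)"
    unfolding uniform_config_def by (rule measurable_restrict)
  moreover have "(\<lambda>z\<in>cells d. global_fun d A c s z) = global_fun d A c s" for c s
    by (auto simp: global_fun_def)
  ultimately show ?thesis by simp
qed

lemma measurable_iterate:
  assumes c: "c \<in> configs d k"
  shows "iterate d A 2 c \<in> measurable \<Omega> (uniform_config d k)"
proof -
  have s: "(\<lambda>s. s i) \<in> measurable \<Omega> (uniform_config d k)" if "i \<in> {1..2}" for i
    using that by (rule measurable_component_singleton)
  have "(\<lambda>s. c) \<in> measurable \<Omega> (uniform_config d k)"
    using c by (intro measurable_const) (simp add: space_config)
  then have "(\<lambda>s. global_fun d A (global_fun d A c (s 1)) (s 2)) \<in> measurable \<Omega> (uniform_config d k)"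
    by (intro measurable_global_fun s) auto
  then show ?thesis by (simp add: iterate_2[abs_def])
qed

lemma pattern_sets:
  assumes "finite J" "J \<subseteq> cells d"
  shows "{e \<in> space (uniform_config d k). \<forall>z\<in>J. e z = \<alpha> z} \<in> sets (uniform_config d k)"
proof (rule sets.sets_Collect_finite_All[OF _ assms(1)])
  fix z assume "z \<in> J"
  then have "z \<in> cells d" using assms by blast
  from measurable_sets[OF measurable_coord[OF measurable_ident this], of "{\<alpha> z}"]
  show "{e \<in> space (uniform_config d k). e z = \<alpha> z} \<in> sets (uniform_config d k)"
    by (simp add: vimage_def Int_def conj_commute)
qed

lemma emeasure_law_pattern:
  assumes "c \<in> configs d k" "finite J" "J \<subseteq> cells d"
  shows "emeasure (law d A 2 c) {e \<in> space (law d A 2 c). \<forall>z\<in>J. e z = \<alpha> z} =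
    emeasure \<Omega> {s \<in> space \<Omega>. \<forall>z\<in>J. iterate d A 2 c s z = \<alpha> z}"
proof -
  have "iterate d A 2 c -` {e \<in> space (uniform_config d k). \<forall>z\<in>J. e z = \<alpha> z} \<inter> space \<Omega> =
      {s \<in> space \<Omega>. \<forall>z\<in>J. iterate d A 2 c s z = \<alpha> z}"
    using measurable_space[OF measurable_iterate[OF assms(1)]] by auto
  then show ?thesis
    using measurable_iterate[OF assms(1)] pattern_sets[OF assms(2,3)]
    by (simp add: law_def emeasure_distr)
qed

text \<open>
  Any two patterns on \<open>J\<close> are interchanged by a coordinatewise permutation of the noise, which
  preserves the measure: transpose the tiles, and flip the bits along a solution of the parity system.
\<close>

definition flip :: "'t \<Rightarrow> 't \<Rightarrow> dir set \<Rightarrow> bool \<Rightarrow> nat \<Rightarrow> nat" where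
  "flip t t' G x i = (let s = dec TS i in
     enc TS (tile1 s, Transposition.transpose t t' (tile2 s), sym_diff (bits s) G, par s \<noteq> x))"

lemma transpose_mem: "t \<in> TS \<Longrightarrow> t' \<in> TS \<Longrightarrow> a \<in> TS \<Longrightarrow> Transposition.transpose t t' a \<in> TS"
  by (auto simp: Transposition.transpose_def)

lemma dec_flip:
  assumes "t \<in> TS" "t' \<in> TS"
  shows "dec TS (flip t t' G x i) = (let s = dec TS i in
     (tile1 s, Transposition.transpose t t' (tile2 s), sym_diff (bits s) G, par s \<noteq> x))"
  using dec_mem[of i] assms by (simp add: flip_def Let_def cstates_iff transpose_mem)

lemma flip_less: "t \<in> TS \<Longrightarrow> t' \<in> TS \<Longrightarrow> flip t t' G x i < k"
  using dec_mem[of i] by (auto simp: flip_def Let_def cstates_iff transpose_mem intro!: enc_less)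

text \<open>Transposition, symmetric difference and negation each undo themselves, so the map is an
  involution and therefore a permutation of the alphabet.\<close>

lemma flip_flip:
  assumes "t \<in> TS" "t' \<in> TS" "i < k"
  shows "flip t t' G x (flip t t' G x i) = i"
proof -
  have "sym_diff (sym_diff H G) G = H" for H :: "dir set" by blast
  moreover have "((p = (\<not> x)) = (\<not> x)) = p" for p by auto
  ultimately have "dec TS (flip t t' G x (flip t t' G x i)) = dec TS i"
    using assms by (simp add: dec_flip Let_def cstate_collapse)
  then show ?thesis using enc_dec flip_less assms by metis
qed

lemma bij_flip: "t \<in> TS \<Longrightarrow> t' \<in> TS \<Longrightarrow> bij_betw (flip t t' G x) {..<k} {..<k}"
  by (rule bij_betw_byWitness[where f'="flip t t' G x"]) (auto simp: flip_flip flip_less)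

lemma pattern_le:
  assumes np: "\<not> has_patch" and c: "c \<in> configs d k" and J: "finite J" "J \<subseteq> cells d"
    and \<alpha>: "\<alpha> \<in> J \<rightarrow>\<^sub>E {..<k}" and \<beta>: "\<beta> \<in> J \<rightarrow>\<^sub>E {..<k}"
  shows "emeasure \<Omega> {s \<in> space \<Omega>. \<forall>z\<in>J. iterate d A 2 c s z = \<alpha> z}
    \<le> emeasure \<Omega> {s \<in> space \<Omega>. \<forall>z\<in>J. iterate d A 2 c s z = \<beta> z}"
proof -
  \<comment> \<open>\<open>B\<close> solves the system for the difference of the two parity
    patterns: adding it to the unknowns moves every equation on \<open>J\<close> from its value
    under \<alpha> to its value under \<beta>.\<close>
  obtain B where B: "\<forall>z\<in>J. odd (card (eqn (control c) z \<inter> B)) \<longleftrightarrow> par (dec TS (\<alpha> z)) \<noteq> par (dec TS (\<beta> z))"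
    using solvable_finite[OF no_patch_control[OF np] J,
        of c "\<lambda>z. par (dec TS (\<alpha> z)) \<noteq> par (dec TS (\<beta> z))"] by blast
  obtain t0 where t0: "t0 \<in> TS" using TS_nonempty by blast
  \<comment> \<open>At time one the edge bits change along \<open>B\<close> also outside
    \<open>J\<close>, where the heads of edges may lie. Tiles and stored bits change on
    \<open>J\<close> only: elsewhere the transposition of \<open>t0\<close> with itself and the
    empty set have no effect.\<close>
  define p :: "nat \<Rightarrow> int list \<Rightarrow> nat \<Rightarrow> nat" where "p i z = (if i = 1
    then flip (if z \<in> J then tile1 (dec TS (\<alpha> z)) else t0) (if z \<in> J then tile1 (dec TS (\<beta> z)) else t0)
           {v. (z, Some v) \<in> B} False
    else flip (if z \<in> J then tile2 (dec TS (\<alpha> z)) else t0) (if z \<in> J then tile2 (dec TS (\<beta> z)) else t0)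
           (if z \<in> J then sym_diff (bits (dec TS (\<alpha> z))) (bits (dec TS (\<beta> z))) else {}) ((z, None) \<in> B))" for i z
  define \<phi> where "\<phi> i x = (\<lambda>z\<in>cells d. p i z (x z))" for i and x :: "int list \<Rightarrow> nat"
  define \<Phi> where "\<Phi> s = (\<lambda>i\<in>{1..2::nat}. \<phi> i (s i))" for s :: "nat \<Rightarrow> int list \<Rightarrow> nat"
  have tm: "tile1 (dec TS i) \<in> TS" "tile2 (dec TS i) \<in> TS" for i
    using dec_mem by (simp_all add: cstates_iff)
  have bij: "bij_betw (p i z) {..<k} {..<k}" for i z
    using t0 tm by (simp add: p_def bij_flip)
  have \<phi>: "\<phi> i \<in> measurable (uniform_config d k) (uniform_config d k)"
    "distr (uniform_config d k) (uniform_config d k) (\<phi> i) = uniform_config d k" for i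
    unfolding uniform_config_def \<phi>_def
    by (intro distr_PiM_components prob_uniform distr_uniform_count_measure_bij[OF _ bij] finite_lessThan)+
  have \<Phi>: "\<Phi> \<in> measurable \<Omega> \<Omega>" "distr \<Omega> \<Omega> \<Phi> = \<Omega>"
    unfolding \<Phi>_def by (intro distr_PiM_components prob_config \<phi>)+
  let ?E = "\<lambda>\<gamma>. {s \<in> space \<Omega>. \<forall>z\<in>J. iterate d A 2 c s z = \<gamma> z}"
  have E: "?E \<gamma> \<in> sets \<Omega>" for \<gamma>
  proof -
    have "iterate d A 2 c -` {e \<in> space (uniform_config d k). \<forall>z\<in>J. e z = \<gamma> z} \<inter> space \<Omega> = ?E \<gamma>"
      using measurable_space[OF measurable_iterate[OF c]] by auto
    then show ?thesis
      using measurable_sets[OF measurable_iterate[OF c] pattern_sets[OF J, of \<gamma>]] by simp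
  qed
  \<comment> \<open>Since \<open>\<Phi>\<close> preserves the measure, it suffices that it maps the
    first event into the second.\<close>
  have "?E \<alpha> \<subseteq> \<Phi> -` ?E \<beta> \<inter> space \<Omega>"
  proof
    fix s assume "s \<in> ?E \<alpha>"
    then have s: "s \<in> space \<Omega>" and eq: "\<forall>z\<in>J. iterate d A 2 c s z = \<alpha> z" by blast+
    have \<Phi>s: "\<Phi> s \<in> space \<Omega>" using measurable_space[OF \<Phi>(1) s] .
    have s12: "s 1 \<in> configs d k" "s 2 \<in> configs d k" and p12: "\<Phi> s 1 \<in> configs d k" "\<Phi> s 2 \<in> configs d k"
      using space_OmegaD[OF s] space_OmegaD[OF \<Phi>s] by blast+
    have d1: "dec TS (\<Phi> s 1 z) = (tile1 (dec TS (s 1 z)),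
        (if z \<in> J then Transposition.transpose (tile1 (dec TS (\<alpha> z))) (tile1 (dec TS (\<beta> z))) (tile2 (dec TS (s 1 z)))
         else tile2 (dec TS (s 1 z))),
        sym_diff (bits (dec TS (s 1 z))) {v. (z, Some v) \<in> B}, par (dec TS (s 1 z)))"
      and d2: "dec TS (\<Phi> s 2 z) = (tile1 (dec TS (s 2 z)),
        (if z \<in> J then Transposition.transpose (tile2 (dec TS (\<alpha> z))) (tile2 (dec TS (\<beta> z))) (tile2 (dec TS (s 2 z)))
         else tile2 (dec TS (s 2 z))),
        (if z \<in> J then sym_diff (bits (dec TS (s 2 z))) (sym_diff (bits (dec TS (\<alpha> z))) (bits (dec TS (\<beta> z))))
         else bits (dec TS (s 2 z))),
        par (dec TS (s 2 z)) \<noteq> ((z, None) \<in> B))"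
      if "z \<in> cells d" for z
      using that t0 tm by (simp_all add: \<Phi>_def \<phi>_def p_def dec_flip Let_def)
    have "iterate d A 2 c (\<Phi> s) z = \<beta> z" if z: "z \<in> J" for z
    proof -
      have zc: "z \<in> cells d" using z J by blast
      have it: "dec TS (\<alpha> z) = (tile2 (dec TS (s 1 z)), tile2 (dec TS (s 2 z)), bits (dec TS (s 2 z)),
        odd (card (eqn (control c) z \<inter> unknowns (s 1) (s 2))))"
        using dec_iterate[of c s, OF c s12 zc] eq z by auto
      have "eqn (control c) z \<subseteq> cells d \<times> UNIV" using zc cells_sh(1) by (auto simp: eqn_def)
      moreover have "y \<in> unknowns (\<Phi> s 1) (\<Phi> s 2) \<longleftrightarrow> y \<in> sym_diff (unknowns (s 1) (s 2)) B"
        if "fst y \<in> cells d" for y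
        using d1[OF that] d2[OF that] by (cases y; cases "snd y") (auto simp: unknowns_def)
      ultimately have "eqn (control c) z \<inter> unknowns (\<Phi> s 1) (\<Phi> s 2) = eqn (control c) z \<inter> sym_diff (unknowns (s 1) (s 2)) B"
        by fastforce
      then have "odd (card (eqn (control c) z \<inter> unknowns (\<Phi> s 1) (\<Phi> s 2))) = par (dec TS (\<beta> z))"
        using odd_card_sym_diff[OF finite_eqn] B z it by auto
      moreover have "sym_diff H (sym_diff H G) = G" for H G :: "dir set" by blast
      ultimately have "dec TS (iterate d A 2 c (\<Phi> s) z) = (tile1 (dec TS (\<beta> z)), tile2 (dec TS (\<beta> z)), bits (dec TS (\<beta> z)), par (dec TS (\<beta> z)))"
        using dec_iterate[of c "\<Phi> s", OF c p12 zc] d1[OF zc] d2[OF zc] z it by simp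
      then have "dec TS (iterate d A 2 c (\<Phi> s) z) = dec TS (\<beta> z)" by (simp add: cstate_collapse)
      moreover have "iterate d A 2 c (\<Phi> s) z < k"
        using configsD[OF iterate_configs[of c "\<Phi> s", OF c p12] zc] .
      moreover have "\<beta> z < k" using \<beta> z by auto
      ultimately show ?thesis by (metis enc_dec)
    qed
    with s \<Phi>s show "s \<in> \<Phi> -` ?E \<beta> \<inter> space \<Omega>" by blast
  qed
  then have "emeasure \<Omega> (?E \<alpha>) \<le> emeasure \<Omega> (\<Phi> -` ?E \<beta> \<inter> space \<Omega>)"
    by (intro emeasure_mono measurable_sets[OF \<Phi>(1)] E)
  also have "\<dots> = emeasure (distr \<Omega> \<Omega> \<Phi>) (?E \<beta>)"
    by (rule emeasure_distr[symmetric, OF \<Phi>(1) E])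
  finally show ?thesis unfolding \<Phi>(2) .
qed

text \<open>A closed patch produces a finite pattern of probability zero under some law, while the
  uniform measure gives every finite pattern positive mass. Without patches all patterns on the same
  finite set are equally likely, which characterizes the uniform measure.\<close>

lemma white_noise_iff: "white_noise_iterate d A 2 \<longleftrightarrow> \<not> has_patch"
proof
  assume white: "white_noise_iterate d A 2"
  show "\<not> has_patch"
  proof
    assume has_patch
    then obtain c Z \<alpha> where c: "c \<in> configs d k" and Z: "finite Z" "Z \<subseteq> cells d" and \<alpha>: "\<alpha> \<in> configs d k"
      and un: "\<forall>s. s 1 \<in> configs d k \<longrightarrow> s 2 \<in> configs d k \<longrightarrow> (\<exists>z\<in>Z. iterate d A 2 c s z \<noteq> \<alpha> z)"
      using unreachable_pattern by blast
    have "{s \<in> space \<Omega>. \<forall>z\<in>Z. iterate d A 2 c s z = \<alpha> z} = {}"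
      using un space_OmegaD by blast
    then have "emeasure (law d A 2 c) {e \<in> space (law d A 2 c). \<forall>z\<in>Z. e z = \<alpha> z} = 0"
      unfolding emeasure_law_pattern[OF c Z] by (simp only: emeasure_empty)
    moreover have "law d A 2 c = uniform_config d k"
      using white c by (simp add: white_noise_iterate_def)
    moreover have "{e \<in> space (uniform_config d k). \<forall>z\<in>Z. e z = \<alpha> z} =
        prod_emb (cells d) (\<lambda>_. uniform_count_measure {..<k}) Z (\<Pi>\<^sub>E z\<in>Z. {\<alpha> z})"
      using Z by (auto simp: prod_emb_def uniform_config_def space_PiM PiE_iff extensional_def)
    moreover have "emeasure (uniform_config d k) (prod_emb (cells d) (\<lambda>_. uniform_count_measure {..<k}) Z (\<Pi>\<^sub>E z\<in>Z. {\<alpha> z})) =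
        (\<Prod>z\<in>Z. emeasure (uniform_count_measure {..<k}) {\<alpha> z})"
      unfolding uniform_config_def using Z configsD[OF \<alpha>]
      by (intro emeasure_PiM_emb prob_uniform) auto
    moreover have "emeasure (uniform_count_measure {..<k}) {\<alpha> z} \<noteq> 0" if "z \<in> Z" for z
      using that Z configsD[OF \<alpha>, of z] k_pos by (subst emeasure_uniform_count_measure) auto
    ultimately show False using Z by simp
  qed
next
  assume np: "\<not> has_patch"
  have "law d A 2 c = uniform_config d k" if c: "c \<in> configs d k" for c
    unfolding uniform_config_def
  proof (rule eq_uniform_PiM)
    show "finite {..<k}" "{..<k} \<noteq> {}" using k_pos by auto
    show "sets (law d A 2 c) = sets (\<Pi>\<^sub>M z\<in>cells d. uniform_count_measure {..<k})"
      by (simp add: law_def uniform_config_def)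
    show "prob_space (law d A 2 c)"
      unfolding law_def A_simps by (intro prob_space.prob_space_distr prob_Omega measurable_iterate c)
    fix J \<alpha> \<beta> assume "finite J" "J \<subseteq> cells d" "\<alpha> \<in> J \<rightarrow>\<^sub>E {..<k}" "\<beta> \<in> J \<rightarrow>\<^sub>E {..<k}"
    then show "emeasure (law d A 2 c) {e \<in> space (law d A 2 c). \<forall>z\<in>J. e z = \<alpha> z}
        \<le> emeasure (law d A 2 c) {e \<in> space (law d A 2 c). \<forall>z\<in>J. e z = \<beta> z}"
      unfolding emeasure_law_pattern[OF c \<open>finite J\<close> \<open>J \<subseteq> cells d\<close>] by (intro pattern_le np c)
  qed
  then show "white_noise_iterate d A 2"
    by (simp add: white_noise_iterate_def)
qed

end

section \<open>The diagonal argument\<close>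

text \<open>The code of the table enters as an opaque argument, so nothing about tiles is computed.
  A nonnegative integer \<open>m\<close> has the code \<open>m + m\<close>, hence addition,
  successor, pairing and constants suffice.\<close>

lemma rec_fun_encode_tile_ca:
  "rec_fun 3 (\<lambda>xs. list_encode [xs ! 0, xs ! 0,
     encode_nbhd [replicate d 0, vec d (xs ! 2) East, vec d (xs ! 2) North, vec d (xs ! 2) Long],
     encode_nbhd [replicate d 0], xs ! 1])"
proof -
  have "int_encode (int m) = m + m" for m
    by (simp add: int_encode_def sum_encode_def)
  then show ?thesis
    by (auto simp: encode_nbhd_def simp del: replicate.simps
        intro!: rec_fun_Suc rec_fun_prod_encode rec_fun_const rec_fun_nth
          rec_fun_comp2[OF rec_fun_add, where n=3])
qed

text \<open>
  Registers 1 and 2 are guessed and compared with the number in register 0 that they determine.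
\<close>

lemma acceptor:
  assumes E: "\<And>x y. recf_eval E [x, y] (e x y)"
  shows "\<exists>P. \<forall>m. (\<exists>\<sigma> \<tau>. psem P \<sigma> \<tau> \<and> \<sigma> 0 = m) \<longleftrightarrow> (\<exists>x y. e x y = m \<and> recf_eval G [x, y, m] 1)"
proof -
  obtain PE where
    E1: "\<And>\<sigma> \<tau>. psem PE \<sigma> \<tau> \<Longrightarrow> \<exists>y. recf_eval E (map \<sigma> [1, 2]) y \<and> agree 6 \<tau> (\<sigma>(3 := y))" and
    E2: "\<And>\<sigma> y. recf_eval E (map \<sigma> [1, 2]) y \<Longrightarrow> \<exists>\<tau>. psem PE \<sigma> \<tau> \<and> agree 6 \<tau> (\<sigma>(3 := y))"
    by (rule compilableE[OF compilable, of "[1, 2]" 6 3]) auto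
  obtain PG where
    G1: "\<And>\<sigma> \<tau>. psem PG \<sigma> \<tau> \<Longrightarrow> \<exists>y. recf_eval G (map \<sigma> [1, 2, 0]) y \<and> agree 6 \<tau> (\<sigma>(4 := y))" and
    G2: "\<And>\<sigma> y. recf_eval G (map \<sigma> [1, 2, 0]) y \<Longrightarrow> \<exists>\<tau>. psem PG \<sigma> \<tau> \<and> agree 6 \<tau> (\<sigma>(4 := y))"
    by (rule compilableE[OF compilable, of "[1, 2, 0]" 6 4]) auto
  \<comment> \<open>Register 3 receives the number determined by the guesses and must equal the
    input; register 4 receives the answer, which must be the successor of the zero in register 5.
    The bound 6 keeps the intermediate results of both subprograms away from these
    registers.\<close>
  define P where "P = Seq PE (Seq (Atom (TestEq 3 0)) (Seq PG (Seq (zero 5) (Atom (TestSuc 4 5)))))"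
  have P: "psem P \<sigma> \<tau> \<longleftrightarrow> (\<exists>\<rho> \<rho>'. psem PE \<sigma> \<rho> \<and> \<rho> 3 = \<rho> 0 \<and> psem PG \<rho> \<rho>' \<and> \<rho>' 4 = 1 \<and> \<tau> = \<rho>'(5 := 0))" for \<sigma> \<tau>
    by (auto simp: P_def OO_def psem_zero)
  have "(\<exists>\<sigma> \<tau>. psem P \<sigma> \<tau> \<and> \<sigma> 0 = m) \<longleftrightarrow> (\<exists>x y. e x y = m \<and> recf_eval G [x, y, m] 1)" for m
  proof
    assume "\<exists>\<sigma> \<tau>. psem P \<sigma> \<tau> \<and> \<sigma> 0 = m"
    then obtain \<sigma> \<rho> \<rho>' where *: "psem PE \<sigma> \<rho>" "\<rho> 3 = \<rho> 0" "psem PG \<rho> \<rho>'" "\<rho>' 4 = 1" "\<sigma> 0 = m"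
      unfolding P by blast
    from E1[OF *(1)] obtain u where u: "recf_eval E [\<sigma> 1, \<sigma> 2] u" "agree 6 \<rho> (\<sigma>(3 := u))" by auto
    from G1[OF *(3)] obtain v where v: "recf_eval G [\<rho> 1, \<rho> 2, \<rho> 0] v" "agree 6 \<rho>' (\<rho>(4 := v))" by auto
    have "u = e (\<sigma> 1) (\<sigma> 2)" using recf_eval_det[OF u(1) E] .
    moreover have "\<rho> 0 = m" "\<rho> 1 = \<sigma> 1" "\<rho> 2 = \<sigma> 2" "\<rho> 3 = u" "v = 1"
      using u(2) v(2) *(4,5) by (auto simp: agree_def)
    ultimately show "\<exists>x y. e x y = m \<and> recf_eval G [x, y, m] 1"
      using v(1) *(2) by (intro exI[of _ "\<sigma> 1"] exI[of _ "\<sigma> 2"]) simp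
  next
    assume "\<exists>x y. e x y = m \<and> recf_eval G [x, y, m] 1"
    then obtain x y where xy: "e x y = m" "recf_eval G [x, y, m] 1" by blast
    define \<sigma> :: "nat \<Rightarrow> nat" where "\<sigma> = (\<lambda>_. 0)(0 := m, 1 := x, 2 := y)"
    have \<sigma>: "\<sigma> 0 = m" "\<sigma> 1 = x" "\<sigma> 2 = y" by (simp_all add: \<sigma>_def)
    have "recf_eval E (map \<sigma> [1, 2]) m" using E[of x y] xy \<sigma> by simp
    from E2[OF this] obtain \<rho> where \<rho>: "psem PE \<sigma> \<rho>" "agree 6 \<rho> (\<sigma>(3 := m))" by blast
    then have r: "\<rho> 0 = m" "\<rho> 1 = x" "\<rho> 2 = y" "\<rho> 3 = m" using \<sigma> by (auto simp: agree_def)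
    have "recf_eval G (map \<rho> [1, 2, 0]) 1" using xy r by simp
    from G2[OF this] obtain \<rho>' where \<rho>': "psem PG \<rho> \<rho>'" "agree 6 \<rho>' (\<rho>(4 := 1))" by blast
    then have "\<rho>' 4 = 1" by (simp add: agree_def)
    with \<rho> \<rho>' r \<sigma> show "\<exists>\<sigma> \<tau>. psem P \<sigma> \<tau> \<and> \<sigma> 0 = m" unfolding P by metis
  qed
  then show ?thesis by blast
qed

text \<open>
  The table of the automaton depends on the program but not on the vector \<open>Long\<close>. The length
  \<open>m\<close> of that vector therefore can encode the table, and the program recovers the code of the
  automaton that runs it.
\<close>

lemma undecidable_if_no_patch:
  assumes d: "d \<ge> 2"
    and Q: "\<And>m P n. m \<ge> 2 \<Longrightarrow> Q (tile_ca d m (tiles P n) (tile_ok P n) tile_out tile_in) \<longleftrightarrow>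
      \<not> tile_automaton.has_patch d m (tiles P n) (tile_ok P n) tile_out tile_in"
  shows "\<not> decidable_problem encode_sca {A. is_cfca d A} Q"
proof
  assume "decidable_problem encode_sca {A. is_cfca d A} Q"
  then obtain f where f: "\<And>A. is_cfca d A \<Longrightarrow> recf_eval f [encode_sca A] (if Q A then 1 else 0)"
    unfolding decidable_problem_def by blast
  define code where "code k t m = list_encode [k, k,
     encode_nbhd [replicate d 0, vec d m East, vec d m North, vec d m Long],
     encode_nbhd [replicate d 0], t]" for k t m
  obtain H where "\<forall>xs. length xs = 3 \<longrightarrow> recf_eval H xs (code (xs ! 0) (xs ! 1) (xs ! 2))"
    using rec_fun_encode_tile_ca[of d] unfolding rec_fun_def code_def by blast
  from spec[OF this, of "[_, _, _]"] have H: "recf_eval H [k, t, m] (code k t m)" for k t m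
    by (simp add: numeral_2_eq_2)
  have "rec_fun 2 (\<lambda>xs. Suc (Suc (prod_encode (xs ! 0, xs ! 1))))"
    by (intro rec_fun_Suc rec_fun_prod_encode rec_fun_nth) auto
  then obtain E where "\<forall>xs. length xs = 2 \<longrightarrow> recf_eval E xs (Suc (Suc (prod_encode (xs ! 0, xs ! 1))))"
    unfolding rec_fun_def by blast
  from spec[OF this, of "[_, _]"] have E: "recf_eval E [k, t] (Suc (Suc (prod_encode (k, t))))" for k t
    by simp
  obtain P where P: "\<And>m. (\<exists>\<sigma> \<tau>. psem P \<sigma> \<tau> \<and> \<sigma> 0 = m) \<longleftrightarrow>
      (\<exists>k t. Suc (Suc (prod_encode (k, t))) = m \<and> recf_eval (Comp f [H]) [k, t, m] 1)"
    using acceptor[OF E, of "Comp f [H]"] by blast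
  obtain n where n: "insert 0 (regs P) \<subseteq> {..<n}"
    using finite_nat_set_iff_bounded[of "insert 0 (regs P)"] finite_regs by auto
  define k where "k = card (cstates (tiles P n))"
  define t where "t = list_encode (tile_table (tiles P n) (tile_ok P n) tile_out tile_in)"
  \<comment> \<open>\<open>P\<close>, \<open>k\<close> and \<open>t\<close> are fixed before the
    input is chosen, so there is no circularity. The pair carries both numbers, and adding two meets
    the lower bound on the length of \<open>Long\<close>.\<close>
  define m where "m = Suc (Suc (prod_encode (k, t)))"
  define A where "A = tile_ca d m (tiles P n) (tile_ok P n) tile_out tile_in"
  interpret tile_automaton d m "tiles P n" "tile_ok P n" tile_out tile_in
    using d finite_tiles tiles_nonempty by unfold_locales (auto simp: m_def)
  have A: "encode_sca A = code k t m"
    by (simp add: A_def encode_sca_def code_def k_def t_def)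
  have "has_patch \<longleftrightarrow> (\<exists>\<sigma> \<tau>. psem P \<sigma> \<tau> \<and> \<sigma> 0 = m)"
  proof
    assume has_patch
    then obtain a Z where "\<forall>z\<in>cells d. a z \<in> tiles P n" "patch a Z" unfolding has_patch_def by blast
    from run_of_closed_patch[OF d n this] show "\<exists>\<sigma> \<tau>. psem P \<sigma> \<tau> \<and> \<sigma> 0 = m" .
  next
    assume "\<exists>\<sigma> \<tau>. psem P \<sigma> \<tau> \<and> \<sigma> 0 = m"
    then obtain \<sigma> \<tau> where "psem P \<sigma> \<tau>" "\<sigma> 0 = m" by blast
    from closed_patch_of_run[OF d n this] show has_patch unfolding has_patch_def by blast
  qed
  \<comment> \<open>As \<open>prod_encode\<close> is injective, \<open>k\<close> and
    \<open>t\<close> are the only guesses that fit the input \<open>m\<close>.\<close>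
  also have "\<dots> \<longleftrightarrow> recf_eval (Comp f [H]) [k, t, m] 1"
    unfolding P by (auto simp: m_def)
  also have "\<dots> \<longleftrightarrow> recf_eval f [encode_sca A] 1"
  proof
    assume "recf_eval (Comp f [H]) [k, t, m] 1"
    then obtain ys where ys: "list_all2 (\<lambda>g y. recf_eval g [k, t, m] y) [H] ys" "recf_eval f ys 1"
      by (rule recf_eval_CompE)
    then obtain y where "ys = [y]" "recf_eval H [k, t, m] y" by (auto simp: list_all2_Cons1)
    with recf_eval_det[OF this(2) H] ys A show "recf_eval f [encode_sca A] 1" by simp
  next
    assume "recf_eval f [encode_sca A] 1"
    then show "recf_eval (Comp f [H]) [k, t, m] 1"
      using H A by (intro eval_Comp[where ys="[code k t m]"]) auto
  qed
  finally have patch: "has_patch \<longleftrightarrow> recf_eval f [encode_sca A] 1" .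
  have "m \<ge> 2" by (simp add: m_def)
  from Q[OF this, of P n] have QA: "Q A \<longleftrightarrow> \<not> has_patch" by (simp add: A_def)
  have fA: "recf_eval f [encode_sca A] (if Q A then 1 else 0)"
    using f is_cfca_A by (simp add: A_def)
  \<comment> \<open>A patch exists iff the algorithm answers 1 on \<open>A\<close>, that is, iff
    \<open>Q A\<close> holds, that is, iff no patch exists.\<close>
  show False
    using fA patch QA recf_eval_det[OF fA, of 1] by (auto split: if_splits)
qed

theorem theorem5p7:
  fixes d :: nat
  assumes "d \<ge> 2"
  shows "\<not> decidable_problem encode_sca {A. is_cfca d A} (\<lambda>A. white_noise_iterate d A 2)
       \<and> \<not> decidable_problem encode_sca {A. is_cfca d A} (\<lambda>A. noisy_iterate d A 2)"
proof -
  have "tile_automaton d m (tiles P n)" if "m \<ge> 2" for m P n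
    using assms that finite_tiles tiles_nonempty by unfold_locales
  then show ?thesis
    by (intro conjI undecidable_if_no_patch[OF assms] tile_automaton.white_noise_iff tile_automaton.noisy_iff)
qed

end
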